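(* Let $\Theta\subset\mathbb R^+=(0,\infty)$ be compact, let $G_0$ be a probability measure on $\Theta$, and let $(\alpha_n)_{n\ge1}\subset(0,1)$ be non-increasing with $\sum_{n\ge1}\alpha_n=+\infty$, $\sum_{n\ge1}\alpha_n^2<+\infty$ and $$\sum_{n\ge1}\Big(\frac{\alpha_n^2}{\sum_{k\ge n}\alpha_k^2}\Big)^2<+\infty.$$ Let $b_n=\big(\sum_{k\ge n}\alpha_k^2\big)^{-1}$. Let $(Y_n)_{n\ge1}$ follow the learning model with learning rate $(\alpha_n)$ and initial guess $G_0$, with associated random measures $(G_n)$ and $\mathbb P$-a.s. weak limit $\tilde G$ (see context). Then, for every $y\in\mathbb N_0$, the conditional distribution of $b_n^{1/2}\big(\hat\theta_{\tilde G}(y)-\hat\theta_{G_n}(y)\big)$ given $\mathcal G_n$ converges weakly, $\mathbb P$-a.s., as $n\to\infty$, to a centered Gaussian kernel with random variance $$W_{\tilde G}(y)=\hat\theta_{\tilde G}^2(y)\sum_{z\in\mathbb N_0}p_{\tilde G}(z)\left(\frac{p_{\tilde G(\cdot\mid z)}(y)}{p_{\tilde G}(y)}-\frac{p_{\tilde G(\cdot\mid z)}(y+1)}{p_{\tilde G}(y+1)}\right)^2,$$ where $p_{\tilde G(\cdot\mid z)}(y)=\int_\Theta\mathrm{Poisson}(y\mid\theta)\,\tilde G(d\theta\mid z)$ with $\tilde G(d\theta\mid z)\propto\mathrm{Poisson}(z\mid\theta)\,\tilde G(d\theta)$.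
   Context: $\mathbb N_0=\{0,1,2,\dots\}$ and $\mathrm{Poisson}(y\mid\theta)=e^{-\theta}\theta^y/y!$. $(Y_n)_{n\ge1}$ is an $\mathbb N_0$-valued sequence on $(\Omega,\mathcal F,\mathbb P)$, $\mathcal G_n=\sigma(Y_1,\dots,Y_n)$, $\mathcal G_0$ trivial. For a probability measure $G$ on $\Theta$, $p_G(y)=\int_\Theta\mathrm{Poisson}(y\mid\theta)\,G(d\theta)$ and $\hat\theta_G(y)=(y+1)\,p_G(y+1)/p_G(y)$. Learning model: for each $n\ge0$, $\mathbb P(Y_{n+1}=y\mid\mathcal G_n)=p_{G_n}(y)$ for $y\in\mathbb N_0$, where the random measures $G_n$ are defined recursively from $G_0$ by $$G_{n+1}(d\theta)=(1-\alpha_{n+1})G_n(d\theta)+\alpha_{n+1}\frac{\mathrm{Poisson}(Y_{n+1}\mid\theta)\,G_n(d\theta)}{\int_\Theta\mathrm{Poisson}(Y_{n+1}\mid\vartheta)\,G_n(d\vartheta)}.$$ Under this model $G_n$ converges weakly $\mathbb P$-a.s. to a random probability measure $\tilde G$ on $\Theta$. A centered Gaussian kernel with random variance $U\ge0$ is the map $\omega\mapsto\mathcal N(0,U(\omega))$ (a point mass at $0$ when $U(\omega)=0$). The convergence means that, for a regular version $K_n(\cdot,\omega)$ of the conditional distribution given $\mathcal G_n$, for $\mathbb P$-almost every $\omega$ the measures $K_n(\cdot,\omega)$ converge weakly to $\mathcal N(0,U(\omega))$. *)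

theory Defs
  imports "HOL-Probability.Probability"
begin

text \<open>
  Probability measures on \<open>\<Theta>\<close> are measures \<open>G\<close> with
  \<open>sets G = sets (restrict_space borel \<Theta>)\<close>, so that integration against \<open>G\<close> is integration
  over \<open>\<Theta>\<close>.
\<close>

definition marginal :: "real measure \<Rightarrow> nat \<Rightarrow> real" where
  "marginal G y = (\<integral>\<theta>. pmf (poisson_pmf \<theta>) y \<partial>G)"

definition bayes_est :: "real measure \<Rightarrow> nat \<Rightarrow> real" where
  "bayes_est G y = (real y + 1) * marginal G (y + 1) / marginal G y"

text \<open>The normalised measure \<open>G(d\<theta> | z) = Poisson(z | \<theta>) G(d\<theta>) / p\<^sub>G(z)\<close>.\<close>

definition posterior :: "real measure \<Rightarrow> nat \<Rightarrow> real measure" where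
  "posterior G z = density G (\<lambda>\<theta>. ennreal (pmf (poisson_pmf \<theta>) z / marginal G z))"

text \<open>The convex combination \<open>(1 - a) G + a H\<close> of two measures on the same \<open>\<sigma>\<close>-algebra.\<close>

definition mixture :: "real \<Rightarrow> 'b measure \<Rightarrow> 'b measure \<Rightarrow> 'b measure" where
  "mixture a G H = measure_of (space G) (sets G)
     (\<lambda>A. ennreal (1 - a) * emeasure G A + ennreal a * emeasure H A)"

lemma sets_mixture [simp]: "sets (mixture a G H) = sets G"
  by (simp add: mixture_def)

lemma space_mixture [simp]: "space (mixture a G H) = space G"
  by (simp add: mixture_def)

lemma emeasure_mixture:
  assumes H: "sets H = sets G" and A: "A \<in> sets G"
  shows "emeasure (mixture a G H) A = ennreal (1 - a) * emeasure G A + ennreal a * emeasure H A"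
  unfolding mixture_def
proof (rule emeasure_measure_of_sigma)
  show "sigma_algebra (space G) (sets G)" ..
  show "positive (sets G) (\<lambda>A. ennreal (1 - a) * emeasure G A + ennreal a * emeasure H A)"
    by (simp add: positive_def)
  show "countably_additive (sets G)
          (\<lambda>A. ennreal (1 - a) * emeasure G A + ennreal a * emeasure H A)"
  proof (rule countably_additiveI)
    fix B :: "nat \<Rightarrow> 'a set"
    assume B: "range B \<subseteq> sets G" "disjoint_family B"
    then have "range B \<subseteq> sets H" using H by simp
    then show "(\<Sum>i. ennreal (1 - a) * emeasure G (B i) + ennreal a * emeasure H (B i)) =
        ennreal (1 - a) * emeasure G (\<Union>i. B i) + ennreal a * emeasure H (\<Union>i. B i)"
      using B by (simp add: suminf_add[symmetric] suminf_emeasure)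
  qed
qed (rule A)

text \<open>
  The recursion for the random measures along an observed path \<open>ys\<close>; observations and
  learning rates are indexed from \<open>1\<close>, and their values at \<open>0\<close> are not used.
\<close>

primrec learned :: "(nat \<Rightarrow> real) \<Rightarrow> real measure \<Rightarrow> (nat \<Rightarrow> nat) \<Rightarrow> nat \<Rightarrow> real measure" where
  "learned \<alpha> G0 ys 0 = G0"
| "learned \<alpha> G0 ys (Suc n) =
     mixture (\<alpha> (Suc n)) (learned \<alpha> G0 ys n) (posterior (learned \<alpha> G0 ys n) (ys (Suc n)))"

definition obs_algebra :: "'a measure \<Rightarrow> (nat \<Rightarrow> 'a \<Rightarrow> nat) \<Rightarrow> nat \<Rightarrow> 'a measure" where
  "obs_algebra M Y n = sigma (space M) {Y i -` A \<inter> space M | i A. i \<in> {1..n}}"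

definition learning_model ::
  "'a measure \<Rightarrow> (nat \<Rightarrow> 'a \<Rightarrow> nat) \<Rightarrow> (nat \<Rightarrow> real) \<Rightarrow> real measure \<Rightarrow> bool" where
  "learning_model M Y \<alpha> G0 \<longleftrightarrow>
     (\<forall>n\<ge>1. Y n \<in> measurable M (count_space UNIV)) \<and>
     (\<forall>n y. AE \<omega> in M.
        real_cond_exp M (obs_algebra M Y n) (indicator (Y (Suc n) -` {y} \<inter> space M)) \<omega>
          = marginal (learned \<alpha> G0 (\<lambda>i. Y i \<omega>) n) y)"

text \<open>
  Weak convergence of measures on the subspace \<open>\<Theta>\<close>; the library's \<^const>\<open>weak_conv_m\<close> is
  restricted to Borel measures on the whole line.
\<close>

definition weak_conv_on :: "real set \<Rightarrow> (nat \<Rightarrow> real measure) \<Rightarrow> real measure \<Rightarrow> bool" where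
  "weak_conv_on \<Theta> Gs G \<longleftrightarrow>
     (\<forall>f :: real \<Rightarrow> real. continuous_on \<Theta> f \<longrightarrow> bounded (f ` \<Theta>) \<longrightarrow>
        (\<lambda>n. \<integral>\<theta>. f \<theta> \<partial>Gs n) \<longlonglongrightarrow> (\<integral>\<theta>. f \<theta> \<partial>G))"

definition regular_cond_distr ::
  "'a measure \<Rightarrow> 'a measure \<Rightarrow> ('a \<Rightarrow> real) \<Rightarrow> ('a \<Rightarrow> real measure) \<Rightarrow> bool" where
  "regular_cond_distr M F X K \<longleftrightarrow>
     K \<in> measurable F (prob_algebra borel) \<and>
     (\<forall>B\<in>sets borel. AE \<omega> in M.
        real_cond_exp M F (indicator (X -` B \<inter> space M)) \<omega> = measure (K \<omega>) B)"

text \<open>\<open>\<N>(0, v)\<close> for a variance \<open>v \<ge> 0\<close>; \<^const>\<open>normal_density\<close> takes the standard deviation.\<close>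

definition centered_gaussian :: "real \<Rightarrow> real measure" where
  "centered_gaussian v =
     (if v = 0 then return borel 0 else density lborel (normal_density 0 (sqrt v)))"

text \<open>
  Regular versions on the real line exist and are almost surely unique, so the existential
  quantifier over versions could equivalently be a universal one; unlike the latter it is not
  vacuous by definition. The sequence starts at \<open>1\<close>.
\<close>

definition cond_distr_conv_gaussian ::
  "'a measure \<Rightarrow> (nat \<Rightarrow> 'a measure) \<Rightarrow> (nat \<Rightarrow> 'a \<Rightarrow> real) \<Rightarrow> ('a \<Rightarrow> real) \<Rightarrow> bool" where
  "cond_distr_conv_gaussian M F X U \<longleftrightarrow>
     U \<in> borel_measurable M \<and> (\<forall>\<omega>\<in>space M. 0 \<le> U \<omega>) \<and>
     (\<exists>K. (\<forall>n\<ge>1. regular_cond_distr M (F n) (X n) (K n)) \<and>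
          (AE \<omega> in M. weak_conv_m (\<lambda>n. K n \<omega>) (centered_gaussian (U \<omega>))))"

definition tail_rate :: "(nat \<Rightarrow> real) \<Rightarrow> nat \<Rightarrow> real" where
  "tail_rate \<alpha> n = inverse (\<Sum>k. (\<alpha> (n + k))\<^sup>2)"

definition limit_variance :: "real measure \<Rightarrow> nat \<Rightarrow> real" where
  "limit_variance G y = (bayes_est G y)\<^sup>2 *
     (\<Sum>z. marginal G z *
        (marginal (posterior G z) y / marginal G y
         - marginal (posterior G z) (y + 1) / marginal G (y + 1))\<^sup>2)"

end

theory Submission
  imports Defs
begin

text \<open>
  Every \<open>\<G>\<^sub>n\<close> is generated by the countably valued path \<open>(Y\<^sub>1, \<dots>, Y\<^sub>n)\<close>, so conditioning means
  conditioning on its atoms, and on an atom \<open>G\<^sub>n\<^sub>+\<^sub>m\<close> is distributed as an \<open>m\<close>-step Markov chain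
  started at the deterministic measure \<open>G\<^sub>n\<close>. Along this chain \<open>\<integral>f dG\<^sub>k\<close> is a martingale for every
  bounded \<open>f\<close>, with increments of size at most \<open>2 B \<alpha>\<^sub>k\<close>, and its normalised conditional variance
  \<open>V\<^sub>f(G\<^sub>k)\<close> is Lipschitz in countably many such martingales. Hence \<open>V\<^sub>f(G\<^sub>k)\<close> may be replaced by
  \<open>V\<^sub>f(G\<^sub>n)\<close> at an expected cost of order \<open>(\<Sum> \<alpha>\<^sub>k\<^sup>2)\<^sup>1\<^sup>/\<^sup>2\<close>, and telescoping characteristic functions
  gives a central limit theorem with an error bound that does not depend on the atom. The estimator
  is a smooth function of two of these martingales and its linearisation error is quadratic. Since
  the bounds are deterministic, letting \<open>m \<rightarrow> \<infinity>\<close> and then \<open>n \<rightarrow> \<infinity>\<close> yields convergence of the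
  conditional characteristic functions outside a null set, and Levy's continuity theorem concludes.
\<close>

section \<open>Expectations under discrete distributions\<close>

text \<open>An almost sure statement would in general force control of exceptional sets for every n
  and every argument t. An error bound shared by all atoms avoids this: only null atoms and paths
  without a weak limit are discarded.

  Compactness inside (0,\<infinity>) makes the bound uniform. Each likelihood lies between
  \<open>lik_lb z\<close> and \<open>lik_ub z\<close>: the former keeps the denominators of the
  estimator away from 0 at the fixed y, the latter is summable over z. Since \<open>lik_lb z\<close>
  tends to 0, it cannot control the denominators of the variance, which is a series over all z;
  these are handled through the shape u^2/v instead.

  The test function is the gradient of the estimator at G_n. It varies with n but is frozen for all
  later steps, so each chain sees one fixed function, bounded by a constant independent of G_n.

  Normalisation and accumulated variance are offset by one index: b_n starts at \<alpha>_n, the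
  increments after time n start at \<alpha>_(n+1). The discrepancy is b_n \<alpha>_n^2, which the
  third summability hypothesis sends to 0; the same quantity controls the Lindeberg error.\<close>

lemma integrable_measure_pmf_bounded:
  fixes f :: "'a \<Rightarrow> 'b::{banach, second_countable_topology}"
  assumes "\<And>x. x \<in> set_pmf p \<Longrightarrow> norm (f x) \<le> B"
  shows "integrable (measure_pmf p) f"
  by (rule measure_pmf.integrable_const_bound[where B = B]) (auto simp: AE_measure_pmf_iff assms)

lemma norm_expectation_pmf_le:
  fixes f :: "'a \<Rightarrow> 'b::{banach, second_countable_topology}"
  assumes "\<And>x. x \<in> set_pmf p \<Longrightarrow> norm (f x) \<le> B"
  shows "norm (measure_pmf.expectation p f) \<le> B"
proof -
  have "norm (measure_pmf.expectation p f) \<le> measure_pmf.expectation p (\<lambda>x. norm (f x))"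
    by (rule integral_norm_bound)
  also have "\<dots> \<le> B"
    by (intro measure_pmf.integral_le_const integrable_measure_pmf_bounded[where B = B])
       (auto simp: AE_measure_pmf_iff assms)
  finally show ?thesis .
qed

lemma expectation_bind_pmf_real:
  fixes f :: "'b \<Rightarrow> real"
  assumes "\<And>x. x \<in> set_pmf (bind_pmf p N) \<Longrightarrow> \<bar>f x\<bar> \<le> B"
  shows "measure_pmf.expectation (bind_pmf p N) f
    = measure_pmf.expectation p (\<lambda>x. measure_pmf.expectation (N x) f)"
proof -
  \<comment> \<open>The hypothesis bounds \<open>f\<close> on the support only, whereas
    \<open>integral_bind\<close> is applied to a globally bounded function. Cutting off outside the
    support changes none of the expectations.\<close>
  define g where "g x = (if x \<in> set_pmf (bind_pmf p N) then f x else 0)" for x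
  have g: "\<bar>g x\<bar> \<le> \<bar>B\<bar>" for x
    using assms[of x] order_trans[OF _ abs_ge_self[of B]] by (simp add: g_def)
  have "measure_pmf.expectation (bind_pmf p N) f = measure_pmf.expectation (bind_pmf p N) g"
    by (intro integral_cong_AE) (auto simp: AE_measure_pmf_iff g_def)
  also have "\<dots> = measure_pmf.expectation p (\<lambda>x. measure_pmf.expectation (N x) g)"
    unfolding measure_pmf_bind
    by (rule integral_bind[where K = "count_space UNIV" and B = "\<bar>B\<bar>" and B' = 1])
       (auto simp: g measure_pmf.finite_measure_axioms measure_pmf_in_subprob_algebra)
  also have "\<dots> = measure_pmf.expectation p (\<lambda>x. measure_pmf.expectation (N x) f)"
    by (intro integral_cong_AE) (auto simp: AE_measure_pmf_iff g_def intro!: integral_cong_AE)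
  finally show ?thesis .
qed

lemma expectation_bind_pmf:
  fixes f :: "'b \<Rightarrow> complex"
  assumes f: "\<And>x. x \<in> set_pmf (bind_pmf p N) \<Longrightarrow> norm (f x) \<le> B"
  shows "measure_pmf.expectation (bind_pmf p N) f
    = measure_pmf.expectation p (\<lambda>x. measure_pmf.expectation (N x) f)"
proof -
  have int: "integrable (measure_pmf (bind_pmf p N)) f"
    by (rule integrable_measure_pmf_bounded[OF f])
  have fN: "norm (f y) \<le> B" if "x \<in> set_pmf p" "y \<in> set_pmf (N x)" for x y
    using that f by auto
  have intN: "integrable (measure_pmf (N x)) f" if "x \<in> set_pmf p" for x
    by (rule integrable_measure_pmf_bounded) (rule fN[OF that])
  have int2: "integrable (measure_pmf p) (\<lambda>x. measure_pmf.expectation (N x) f)"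
    by (rule integrable_measure_pmf_bounded[where B = B]) (rule norm_expectation_pmf_le[OF fN])
  have Re: "\<bar>Re (f x)\<bar> \<le> B" and Im: "\<bar>Im (f x)\<bar> \<le> B" if "x \<in> set_pmf (bind_pmf p N)" for x
    using f[OF that] abs_Re_le_cmod[of "f x"] abs_Im_le_cmod[of "f x"] by linarith+
  show ?thesis
  proof (rule complex_eqI)
    show "Re (measure_pmf.expectation (bind_pmf p N) f)
        = Re (measure_pmf.expectation p (\<lambda>x. measure_pmf.expectation (N x) f))"
      unfolding integral_Re[OF int, symmetric] integral_Re[OF int2, symmetric]
      by (subst expectation_bind_pmf_real[OF Re])
         (auto intro!: integral_cong_AE simp: AE_measure_pmf_iff intN)
    show "Im (measure_pmf.expectation (bind_pmf p N) f)
        = Im (measure_pmf.expectation p (\<lambda>x. measure_pmf.expectation (N x) f))"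
      unfolding integral_Im[OF int, symmetric] integral_Im[OF int2, symmetric]
      by (subst expectation_bind_pmf_real[OF Im])
         (auto intro!: integral_cong_AE simp: AE_measure_pmf_iff intN)
  qed
qed

lemma sums_expectation_pmf_nat:
  fixes f :: "nat \<Rightarrow> 'b::{banach, second_countable_topology}"
  assumes "integrable (measure_pmf p) f"
  shows "(\<lambda>z. pmf p z *\<^sub>R f z) sums measure_pmf.expectation p f"
proof -
  have "integrable (count_space UNIV) (\<lambda>z. pmf p z *\<^sub>R f z)"
    using assms unfolding measure_pmf_eq_density[of p] by (subst (asm) integrable_density) auto
  then have "(\<lambda>z. pmf p z *\<^sub>R f z) sums (\<integral>z. pmf p z *\<^sub>R f z \<partial>count_space UNIV)"
    by (rule sums_integral_count_space_nat)
  then show ?thesis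
    unfolding measure_pmf_eq_density[of p] by (subst integral_density) auto
qed

text \<open>Jensen for the square; it converts the second-moment bound \<open>chain_square\<close>
  into the first-moment bound \<open>chain_mean_dist\<close>.\<close>

lemma expectation_pmf_abs_le_sqrt:
  fixes f :: "'a \<Rightarrow> real"
  assumes "\<And>x. x \<in> set_pmf p \<Longrightarrow> \<bar>f x\<bar> \<le> B"
    and "measure_pmf.expectation p (\<lambda>x. (f x)\<^sup>2) \<le> v"
  shows "measure_pmf.expectation p (\<lambda>x. \<bar>f x\<bar>) \<le> sqrt v"
proof -
  have sq: "\<bar>f x\<bar>\<^sup>2 \<le> B\<^sup>2" if "x \<in> set_pmf p" for x
    using assms(1)[OF that] by (intro power_mono) auto
  have "(measure_pmf.expectation p (\<lambda>x. \<bar>f x\<bar>))\<^sup>2 \<le> measure_pmf.expectation p (\<lambda>x. \<bar>f x\<bar>\<^sup>2)"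
  proof (rule measure_pmf.jensens_inequality[where I = UNIV])
    show "integrable (measure_pmf p) (\<lambda>x. \<bar>f x\<bar>)"
      by (rule integrable_measure_pmf_bounded[where B = B]) (simp add: assms(1))
    show "integrable (measure_pmf p) (\<lambda>x. \<bar>f x\<bar>\<^sup>2)"
      by (rule integrable_measure_pmf_bounded[where B = "B\<^sup>2"]) (use sq in simp)
    show "convex_on UNIV (\<lambda>x :: real. x\<^sup>2)"
      by (rule convex_power2)
  qed auto
  also have "\<dots> \<le> v"
    using assms(2) by simp
  finally show ?thesis
    by (rule real_le_rsqrt)
qed

section \<open>One learning step\<close>

text \<open>\<open>embed_pmf\<close> carries the intended weights only if they are nonnegative and
  sum to 1; \<open>pmf_predictive\<close> establishes this for mixing measures.\<close>

definition predictive :: "real measure \<Rightarrow> nat pmf" where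
  "predictive G = embed_pmf (marginal G)"

definition update :: "real \<Rightarrow> real measure \<Rightarrow> nat \<Rightarrow> real measure" where
  "update a G z = mixture a G (posterior G z)"

text \<open>Times the learning rate, this is the increment of the martingale \<integral>f dG_k when
  z is observed (\<open>integral_update\<close>).\<close>

definition innovation :: "(real \<Rightarrow> real) \<Rightarrow> real measure \<Rightarrow> nat \<Rightarrow> real" where
  "innovation f G z = (\<integral>\<theta>. f \<theta> \<partial>posterior G z) - (\<integral>\<theta>. f \<theta> \<partial>G)"

text \<open>The functional V_f of the overview. It is a genuine variance because the innovation is
  centred, by \<open>expectation_innovation\<close>.\<close>

definition innovation_var :: "(real \<Rightarrow> real) \<Rightarrow> real measure \<Rightarrow> real" where
  "innovation_var f G = measure_pmf.expectation (predictive G) (\<lambda>z. (innovation f G z)\<^sup>2)"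

abbreviation likelihood :: "nat \<Rightarrow> real \<Rightarrow> real" where
  "likelihood z \<theta> \<equiv> pmf (poisson_pmf \<theta>) z"

locale mixing_support =
  fixes \<Theta> :: "real set" and r R :: real
  assumes \<Theta>_borel: "\<Theta> \<in> sets borel" and \<Theta>_bounds: "\<Theta> \<subseteq> {r..R}" and r_pos: "0 < r" and r_le_R: "r \<le> R"
begin

text \<open>Phrased as the space of \<open>prob_algebra\<close>, so that
  \<open>measurable_space\<close> places the values of a random mixing measure in this set.\<close>

abbreviation mixing :: "real measure set" where
  "mixing \<equiv> space (prob_algebra (restrict_space borel \<Theta>))"

abbreviation bounded_on :: "(real \<Rightarrow> real) \<Rightarrow> real \<Rightarrow> bool" where
  "bounded_on f B \<equiv> f \<in> borel_measurable (restrict_space borel \<Theta>) \<and> (\<forall>\<theta>\<in>\<Theta>. \<bar>f \<theta>\<bar> \<le> B)"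

text \<open>The factor exp (-\<theta>) is dropped, which leaves the exponential series in R: an
  envelope summable over all observations.\<close>

definition lik_ub :: "nat \<Rightarrow> real" where "lik_ub z = R ^ z / fact z"

definition lik_lb :: "nat \<Rightarrow> real" where "lik_lb z = r ^ z / fact z * exp (- R)"

lemma R_pos: "0 < R"
  using r_pos r_le_R by linarith

lemma lik_lb_pos: "0 < lik_lb z"
  using r_pos by (simp add: lik_lb_def)

lemma lik_ub_nonneg: "0 \<le> lik_ub z"
  using R_pos by (simp add: lik_ub_def)

lemma lik_ub_sums: "lik_ub sums exp R"
  using exp_converges[of R] by (simp add: lik_ub_def[abs_def] divide_inverse mult.commute)

lemma likelihood_eq: "\<theta> \<in> \<Theta> \<Longrightarrow> likelihood z \<theta> = \<theta> ^ z / fact z * exp (- \<theta>)"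
  using \<Theta>_bounds r_pos by (subst pmf_poisson) force+

lemma likelihood_le: "\<theta> \<in> \<Theta> \<Longrightarrow> likelihood z \<theta> \<le> lik_ub z"
proof -
  assume \<theta>: "\<theta> \<in> \<Theta>"
  then have "0 < \<theta>" "\<theta> \<le> R" using \<Theta>_bounds r_pos by force+
  then have "\<theta> ^ z * exp (- \<theta>) \<le> R ^ z * 1"
    by (intro mult_mono power_mono) auto
  then show ?thesis using \<theta> by (simp add: likelihood_eq lik_ub_def divide_right_mono)
qed

lemma likelihood_ge: "\<theta> \<in> \<Theta> \<Longrightarrow> lik_lb z \<le> likelihood z \<theta>"
proof -
  assume \<theta>: "\<theta> \<in> \<Theta>"
  then have "r \<le> \<theta>" "\<theta> \<le> R" using \<Theta>_bounds by force+
  then have "r ^ z * exp (- R) \<le> \<theta> ^ z * exp (- \<theta>)"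
    using r_pos by (intro mult_mono power_mono) auto
  then show ?thesis using \<theta> by (simp add: likelihood_eq lik_lb_def divide_right_mono)
qed

text \<open>Measurability comes from the closed form of the Poisson weights, valid for the positive
  \<theta> in \<Theta>. Both bounds are kept: \<open>lik_ub z\<close> for series over z, the
  constant 1 where finitely many observations matter.\<close>

lemma likelihood_bounded_on: "bounded_on (likelihood z) (lik_ub z)" "bounded_on (likelihood z) 1"
proof -
  have "likelihood z \<in> borel_measurable (restrict_space borel \<Theta>)
    \<longleftrightarrow> (\<lambda>\<theta>. \<theta> ^ z / fact z * exp (- \<theta>)) \<in> borel_measurable (restrict_space borel \<Theta>)"
    by (rule measurable_cong) (simp add: space_restrict_space likelihood_eq)
  also have "\<dots>"
    by (rule measurable_restrict_space1) measurable
  finally show "bounded_on (likelihood z) (lik_ub z)" "bounded_on (likelihood z) 1"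
    by (auto simp: likelihood_le pmf_le_1)
qed

lemma mixingD:
  assumes "G \<in> mixing"
  shows "prob_space G" "sets G = sets (restrict_space borel \<Theta>)" "space G = \<Theta>"
  using assms sets_eq_imp_space_eq[of G "restrict_space borel \<Theta>"]
  by (auto simp: space_prob_algebra space_restrict_space)

lemma measurable_mixing:
  "G \<in> mixing \<Longrightarrow> f \<in> borel_measurable (restrict_space borel \<Theta>) \<Longrightarrow> f \<in> borel_measurable G"
  using mixingD(2) measurable_cong_sets by blast

lemma bounded_on_integrable: "G \<in> mixing \<Longrightarrow> bounded_on f B \<Longrightarrow> integrable G f"
  using mixingD(3) measurable_mixing
  by (intro finite_measure.integrable_const_bound[where B = B])
     (auto intro: prob_space.finite_measure mixingD(1))

lemma bounded_on_abs_integral_le: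
  assumes G: "G \<in> mixing" and f: "bounded_on f B"
  shows "\<bar>\<integral>\<theta>. f \<theta> \<partial>G\<bar> \<le> B"
proof -
  interpret prob_space G by (rule mixingD[OF G])
  have "\<bar>\<integral>\<theta>. f \<theta> \<partial>G\<bar> \<le> (\<integral>\<theta>. \<bar>f \<theta>\<bar> \<partial>G)"
    by (rule integral_abs_bound)
  also have "\<dots> \<le> B"
    using f bounded_on_integrable[OF G f] mixingD(3)[OF G] by (intro integral_le_const) auto
  finally show ?thesis .
qed

lemma bounded_on_mult: "bounded_on f B \<Longrightarrow> bounded_on g C \<Longrightarrow> bounded_on (\<lambda>\<theta>. f \<theta> * g \<theta>) (B * C)"
  by (auto simp: abs_mult intro!: mult_mono intro: order_trans[OF abs_ge_zero])

lemma bounded_on_diff: "bounded_on f B \<Longrightarrow> bounded_on g C \<Longrightarrow> bounded_on (\<lambda>\<theta>. f \<theta> - g \<theta>) (B + C)"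
  by (auto intro!: order_trans[OF abs_triangle_ineq4] add_mono)

lemma bounded_on_cmult: "bounded_on f B \<Longrightarrow> bounded_on (\<lambda>\<theta>. c * f \<theta>) (\<bar>c\<bar> * B)"
  by (auto simp: abs_mult intro!: mult_left_mono)

lemma
  assumes G: "G \<in> mixing"
  shows marginal_ge: "lik_lb z \<le> marginal G z"
    and marginal_le: "marginal G z \<le> lik_ub z"
    and marginal_le_1: "marginal G z \<le> 1"
    and marginal_pos: "0 < marginal G z"
proof -
  interpret prob_space G by (rule mixingD[OF G])
  show *: "lik_lb z \<le> marginal G z"
    unfolding marginal_def using bounded_on_integrable[OF G likelihood_bounded_on(1)] mixingD(3)[OF G]
    by (intro integral_ge_const) (auto simp: likelihood_ge)
  show "marginal G z \<le> lik_ub z" "marginal G z \<le> 1"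
    unfolding marginal_def using bounded_on_abs_integral_le[OF G likelihood_bounded_on(1)[of z]]
      bounded_on_abs_integral_le[OF G likelihood_bounded_on(2)[of z]] by auto
  show "0 < marginal G z" using * lik_lb_pos[of z] by linarith
qed

text \<open>Poisson weights sum to 1 for each \<theta>, and the envelope \<open>lik_ub z * B\<close>
  justifies exchanging sum and integral. With f = 1 the marginals sum to 1; general f yields the
  martingale property.\<close>

lemma likelihood_integral_sums:
  assumes G: "G \<in> mixing" and f: "bounded_on f B"
  shows "(\<lambda>z. \<integral>\<theta>. likelihood z \<theta> * f \<theta> \<partial>G) sums (\<integral>\<theta>. f \<theta> \<partial>G)"
proof -
  have B: "bounded_on (\<lambda>\<theta>. likelihood z \<theta> * f \<theta>) (lik_ub z * B)" for z
    by (rule bounded_on_mult[OF likelihood_bounded_on(1) f])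
  have nB: "bounded_on (\<lambda>\<theta>. norm (likelihood z \<theta> * f \<theta>)) (lik_ub z * B)" for z
    using B[of z] by auto
  have pt: "(\<lambda>z. likelihood z \<theta> * f \<theta>) sums f \<theta>" for \<theta>
    using sums_mult2[OF sums_expectation_pmf_nat[of "poisson_pmf \<theta>" "\<lambda>_. 1 :: real"], of "f \<theta>"]
    by simp
  have summ: "summable (\<lambda>z. lik_ub z * B)"
    using lik_ub_sums by (intro summable_mult2) (rule sums_summable)
  have "(\<lambda>z. \<integral>\<theta>. likelihood z \<theta> * f \<theta> \<partial>G) sums (\<integral>\<theta>. (\<Sum>z. likelihood z \<theta> * f \<theta>) \<partial>G)"
  proof (rule sums_integral)
    show "integrable G (\<lambda>\<theta>. likelihood z \<theta> * f \<theta>)" for z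
      by (rule bounded_on_integrable[OF G B])
    show "AE \<theta> in G. summable (\<lambda>z. norm (likelihood z \<theta> * f \<theta>))"
    proof (rule AE_I2)
      fix \<theta> assume "\<theta> \<in> space G"
      then show "summable (\<lambda>z. norm (likelihood z \<theta> * f \<theta>))"
        using nB mixingD(3)[OF G] by (intro summable_comparison_test'[OF summ]) auto
    qed
    show "summable (\<lambda>z. \<integral>\<theta>. norm (likelihood z \<theta> * f \<theta>) \<partial>G)"
      using bounded_on_abs_integral_le[OF G nB] by (intro summable_comparison_test'[OF summ]) auto
  qed
  then show ?thesis
    using pt by (simp add: sums_iff)
qed

lemma marginal_sums: "G \<in> mixing \<Longrightarrow> marginal G sums 1"
  using likelihood_integral_sums[of G "\<lambda>_. 1" 1] prob_space.prob_space[OF mixingD(1), of G]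
  by (simp add: marginal_def[abs_def])

lemma pmf_predictive: "G \<in> mixing \<Longrightarrow> pmf (predictive G) z = marginal G z"
  unfolding predictive_def
proof (rule pmf_embed_pmf)
  assume G: "G \<in> mixing"
  show nn: "0 \<le> marginal G x" for x using marginal_pos[OF G, of x] by simp
  have "(\<integral>\<^sup>+x. ennreal (marginal G x) \<partial>count_space UNIV) = (\<Sum>x. ennreal (marginal G x))"
    by (rule nn_integral_count_space_nat)
  also have "\<dots> = ennreal 1"
    by (rule suminf_ennreal_eq[OF nn marginal_sums[OF G]])
  finally show "(\<integral>\<^sup>+x. ennreal (marginal G x) \<partial>count_space UNIV) = 1" by simp
qed

lemma integral_posterior:
  assumes G: "G \<in> mixing" and f: "f \<in> borel_measurable (restrict_space borel \<Theta>)"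
  shows "(\<integral>\<theta>. f \<theta> \<partial>posterior G z) = (\<integral>\<theta>. likelihood z \<theta> * f \<theta> \<partial>G) / marginal G z"
proof -
  note [measurable] = measurable_mixing[OF G f]
    measurable_mixing[OF G likelihood_bounded_on(1)[THEN conjunct1], of z]
  have "(\<integral>\<theta>. f \<theta> \<partial>posterior G z) = (\<integral>\<theta>. (likelihood z \<theta> / marginal G z) *\<^sub>R f \<theta> \<partial>G)"
    unfolding posterior_def using marginal_pos[OF G, of z]
    by (intro integral_density) auto
  then show ?thesis by simp
qed

lemma posterior_mixing:
  assumes G: "G \<in> mixing"
  shows "posterior G z \<in> mixing"
proof -
  note [measurable] = measurable_mixing[OF G likelihood_bounded_on(1)[THEN conjunct1], of z]
  have "emeasure (posterior G z) (space (posterior G z))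
      = (\<integral>\<^sup>+\<theta>. ennreal (likelihood z \<theta> / marginal G z) \<partial>G)"
    by (simp add: posterior_def emeasure_density cong: nn_integral_cong)
  also have "\<dots> = ennreal (\<integral>\<theta>. likelihood z \<theta> / marginal G z \<partial>G)"
    using bounded_on_integrable[OF G likelihood_bounded_on(1), of z] marginal_pos[OF G, of z]
    by (intro nn_integral_eq_integral) auto
  also have "\<dots> = 1"
    using marginal_pos[OF G, of z] by (simp add: marginal_def)
  finally have "prob_space (posterior G z)" by (rule prob_spaceI)
  then show ?thesis
    using mixingD(2)[OF G] by (simp add: space_prob_algebra posterior_def)
qed

lemma
  assumes G: "G \<in> mixing" and a: "0 \<le> a" "a \<le> 1"
  shows update_mixing: "update a G z \<in> mixing"
    and integral_update: "bounded_on f B \<Longrightarrow>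
      (\<integral>\<theta>. f \<theta> \<partial>update a G z) = (\<integral>\<theta>. f \<theta> \<partial>G) + a * innovation f G z"
proof -
  let ?p = "\<lambda>\<theta>. likelihood z \<theta> / marginal G z"
  let ?w = "\<lambda>\<theta>. (1 - a) + a * ?p \<theta>"
  note [measurable] = measurable_mixing[OF G likelihood_bounded_on(1)[THEN conjunct1], of z]
  have p0: "0 \<le> ?p \<theta>" for \<theta> using marginal_pos[OF G, of z] by simp
  have w0: "0 \<le> ?w \<theta>" for \<theta>
    using a mult_nonneg_nonneg[OF a(1) p0[of \<theta>]] by simp
  have w: "ennreal (?w \<theta>) = ennreal (1 - a) + ennreal a * ennreal (?p \<theta>)" for \<theta>
    unfolding ennreal_mult[OF a(1) p0, symmetric] using a mult_nonneg_nonneg[OF a(1) p0]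
    by (intro ennreal_plus) auto
  \<comment> \<open>The mixture is given by its values on sets. Rewriting it as a single density
    with respect to \<open>G\<close> makes integrals against it computable.\<close>
  have eq: "update a G z = density G (\<lambda>\<theta>. ennreal (?w \<theta>))"
    unfolding update_def
  proof (rule measure_eqI)
    show "sets (mixture a G (posterior G z)) = sets (density G (\<lambda>\<theta>. ennreal (?w \<theta>)))" by simp
    fix A assume "A \<in> sets (mixture a G (posterior G z))"
    then have A[measurable]: "A \<in> sets G" by simp
    have "emeasure (density G (\<lambda>\<theta>. ennreal (?w \<theta>))) A
        = (\<integral>\<^sup>+\<theta>. ennreal (1 - a) * indicator A \<theta> + ennreal a * (ennreal (?p \<theta>) * indicator A \<theta>) \<partial>G)"
      using w by (subst emeasure_density)
        (auto intro!: nn_integral_cong split: split_indicator)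
    also have "\<dots> = ennreal (1 - a) * emeasure G A + ennreal a * emeasure (posterior G z) A"
      unfolding posterior_def
      by (subst nn_integral_add) (simp_all add: nn_integral_cmult emeasure_density)
    also have "\<dots> = emeasure (mixture a G (posterior G z)) A"
      by (rule emeasure_mixture[symmetric]) (simp_all add: posterior_def)
    finally show "emeasure (mixture a G (posterior G z)) A
        = emeasure (density G (\<lambda>\<theta>. ennreal (?w \<theta>))) A" by simp
  qed
  show int: "(\<integral>\<theta>. f \<theta> \<partial>update a G z) = (\<integral>\<theta>. f \<theta> \<partial>G) + a * innovation f G z" if f: "bounded_on f B" for f B
  proof -
    have [measurable]: "f \<in> borel_measurable G" using f measurable_mixing[OF G] by blast
    have i1: "integrable G f" by (rule bounded_on_integrable[OF G f])
    have i2: "integrable G (\<lambda>\<theta>. likelihood z \<theta> * f \<theta>)"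
      by (rule bounded_on_integrable[OF G bounded_on_mult[OF likelihood_bounded_on(1) f]])
    have "(\<integral>\<theta>. f \<theta> \<partial>update a G z) = (\<integral>\<theta>. ?w \<theta> *\<^sub>R f \<theta> \<partial>G)"
      unfolding eq by (intro integral_density AE_I2 w0) auto
    also have "\<dots> = (\<integral>\<theta>. (1 - a) * f \<theta> + (a / marginal G z) * (likelihood z \<theta> * f \<theta>) \<partial>G)"
      by (simp add: algebra_simps)
    also have "\<dots> = (1 - a) * (\<integral>\<theta>. f \<theta> \<partial>G) + (a / marginal G z) * (\<integral>\<theta>. likelihood z \<theta> * f \<theta> \<partial>G)"
      using i1 i2 by simp
    also have "\<dots> = (\<integral>\<theta>. f \<theta> \<partial>G) + a * innovation f G z"
      using f by (simp add: innovation_def integral_posterior[OF G] algebra_simps)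
    finally show ?thesis .
  qed
  have "prob_space (update a G z)"
  proof
    have "emeasure (mixture a G (posterior G z)) (space G)
      = ennreal (1 - a) * emeasure G (space G) + ennreal a * emeasure (posterior G z) (space G)"
      by (intro emeasure_mixture) (simp_all add: posterior_def)
    also have "\<dots> = ennreal (1 - a) + ennreal a"
      using prob_space.emeasure_space_1[OF mixingD(1)[OF G]] mixingD(3)[OF G] mixingD(3)[OF posterior_mixing[OF G]]
        prob_space.emeasure_space_1[OF mixingD(1)[OF posterior_mixing[OF G, of z]]]
      by simp
    also have "\<dots> = 1" using a by (simp flip: ennreal_plus)
    finally show "emeasure (update a G z) (space (update a G z)) = 1"
      by (simp add: update_def)
  qed
  then show "update a G z \<in> mixing"
    using mixingD(2)[OF G] by (simp add: space_prob_algebra update_def)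
qed

text \<open>Puts u = \<integral>k_z f dG and v = p_G(z), with k_z the likelihood, in the cone |u|
  \<le> B v on which u^2/v is Lipschitz.\<close>

lemma integral_likelihood_abs_le:
  assumes "G \<in> mixing" "bounded_on f B"
  shows "\<bar>\<integral>\<theta>. likelihood z \<theta> * f \<theta> \<partial>G\<bar> \<le> B * marginal G z"
proof -
  have B: "bounded_on (\<lambda>\<theta>. likelihood z \<theta> * f \<theta>) (lik_ub z * B)"
    by (rule bounded_on_mult[OF likelihood_bounded_on(1) assms(2)])
  have i1: "integrable G (\<lambda>\<theta>. likelihood z \<theta> * f \<theta>)"
    by (rule bounded_on_integrable[OF assms(1) B])
  have i2: "integrable G (likelihood z)"
    by (rule bounded_on_integrable[OF assms(1) likelihood_bounded_on(1)])
  have "\<bar>\<integral>\<theta>. likelihood z \<theta> * f \<theta> \<partial>G\<bar> \<le> (\<integral>\<theta>. \<bar>likelihood z \<theta> * f \<theta>\<bar> \<partial>G)"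
    by (rule integral_abs_bound)
  also have "\<dots> \<le> (\<integral>\<theta>. B * likelihood z \<theta> \<partial>G)"
    using integrable_abs[OF i1] i2 assms(2) mixingD(3)[OF assms(1)]
    by (intro integral_mono) (auto simp: abs_mult mult.commute[of _ "likelihood z _"] intro!: mult_left_mono)
  finally show ?thesis by (simp add: marginal_def)
qed

lemma abs_integral_posterior_le:
  "G \<in> mixing \<Longrightarrow> bounded_on f B \<Longrightarrow> \<bar>\<integral>\<theta>. f \<theta> \<partial>posterior G z\<bar> \<le> B"
  by (rule bounded_on_abs_integral_le[OF posterior_mixing])

lemma abs_innovation_le: "G \<in> mixing \<Longrightarrow> bounded_on f B \<Longrightarrow> \<bar>innovation f G z\<bar> \<le> 2 * B"
  using abs_integral_posterior_le[of G f B z] bounded_on_abs_integral_le[of G f B]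
  by (simp add: innovation_def)

lemma integrable_innovation:
  assumes "G \<in> mixing" "bounded_on f B"
  shows "integrable (measure_pmf p) (innovation f G)"
    and "integrable (measure_pmf p) (\<lambda>z. (innovation f G z)\<^sup>2)"
proof -
  show "integrable (measure_pmf p) (innovation f G)"
    by (rule integrable_measure_pmf_bounded[where B = "2 * B"]) (simp add: abs_innovation_le[OF assms])
  show "integrable (measure_pmf p) (\<lambda>z. (innovation f G z)\<^sup>2)"
    using power_mono[OF abs_innovation_le[OF assms] abs_ge_zero, of _ 2]
    by (intro integrable_measure_pmf_bounded[where B = "(2 * B)\<^sup>2"]) simp
qed

text \<open>The predictive weight p_G(z) cancels the normalising constant of the posterior, so
  averaging posterior means over z gives back the prior mean.\<close>

lemma expectation_innovation:
  assumes G: "G \<in> mixing" and f: "bounded_on f B"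
  shows "measure_pmf.expectation (predictive G) (innovation f G) = 0"
proof -
  let ?m = "\<integral>\<theta>. f \<theta> \<partial>G"
  have "(\<lambda>z. (\<integral>\<theta>. likelihood z \<theta> * f \<theta> \<partial>G) - marginal G z * ?m) sums (?m - 1 * ?m)"
    by (intro sums_diff likelihood_integral_sums[OF G f] sums_mult2 marginal_sums[OF G])
  moreover have "(\<integral>\<theta>. likelihood z \<theta> * f \<theta> \<partial>G) - marginal G z * ?m
      = pmf (predictive G) z *\<^sub>R innovation f G z" for z
    using f marginal_pos[OF G, of z]
    by (simp add: pmf_predictive[OF G] innovation_def integral_posterior[OF G] field_simps)
  ultimately show ?thesis
    using sums_expectation_pmf_nat[OF integrable_innovation(1)[OF G f], of "predictive G"]
      sums_unique2 by force
qed

text \<open>Expanding the square shows the variance as second moment minus squared mean. The second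
  moment of the posterior mean is a series of terms u^2/v, the shape in which small marginals do no
  harm.\<close>

lemma innovation_var_sums:
  assumes G: "G \<in> mixing" and f: "bounded_on f B"
  shows "(\<lambda>z. (\<integral>\<theta>. likelihood z \<theta> * f \<theta> \<partial>G)\<^sup>2 / marginal G z)
    sums (innovation_var f G + (\<integral>\<theta>. f \<theta> \<partial>G)\<^sup>2)"
proof -
  let ?m = "\<integral>\<theta>. f \<theta> \<partial>G" and ?u = "\<lambda>z. \<integral>\<theta>. likelihood z \<theta> * f \<theta> \<partial>G"
  have "(\<lambda>z. pmf (predictive G) z *\<^sub>R (innovation f G z)\<^sup>2) sums innovation_var f G"
    unfolding innovation_var_def by (rule sums_expectation_pmf_nat[OF integrable_innovation(2)[OF G f]])
  then have "(\<lambda>z. pmf (predictive G) z *\<^sub>R (innovation f G z)\<^sup>2 + 2 * ?m * ?u z - ?m\<^sup>2 * marginal G z)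
      sums (innovation_var f G + 2 * ?m * ?m - ?m\<^sup>2 * 1)"
    by (intro sums_add sums_diff sums_mult likelihood_integral_sums[OF G f] marginal_sums[OF G])
  moreover have "pmf (predictive G) z *\<^sub>R (innovation f G z)\<^sup>2 + 2 * ?m * ?u z - ?m\<^sup>2 * marginal G z
      = (?u z)\<^sup>2 / marginal G z" for z
    using f marginal_pos[OF G, of z]
    by (simp add: pmf_predictive[OF G] innovation_def integral_posterior[OF G] field_simps power2_eq_square)
  ultimately show ?thesis by (simp add: power2_eq_square add.commute)
qed

text \<open>A variance is at most the second moment, and posterior means are bounded by B; this
  gives B^2 where the bound 2 B on the innovation would give 4 B^2.\<close>

lemma
  assumes G: "G \<in> mixing" and f: "bounded_on f B"
  shows innovation_var_nonneg: "0 \<le> innovation_var f G"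
    and innovation_var_le: "innovation_var f G \<le> B\<^sup>2"
proof -
  show "0 \<le> innovation_var f G"
    unfolding innovation_var_def by (rule Bochner_Integration.integral_nonneg) auto
  have "(\<integral>\<theta>. likelihood z \<theta> * f \<theta> \<partial>G)\<^sup>2 / marginal G z \<le> B\<^sup>2 * marginal G z" for z
  proof -
    have "(\<integral>\<theta>. likelihood z \<theta> * f \<theta> \<partial>G)\<^sup>2 \<le> (B * marginal G z)\<^sup>2"
      using power_mono[OF integral_likelihood_abs_le[OF G f, of z], of 2] by simp
    then show ?thesis
      using marginal_pos[OF G, of z] by (simp add: divide_le_eq power2_eq_square ac_simps)
  qed
  then have "innovation_var f G + (\<integral>\<theta>. f \<theta> \<partial>G)\<^sup>2 \<le> B\<^sup>2 * 1"
    by (rule sums_le[OF _ innovation_var_sums[OF G f] sums_mult[OF marginal_sums[OF G]]])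
  then show "innovation_var f G \<le> B\<^sup>2"
    using zero_le_power2[of "\<integral>\<theta>. f \<theta> \<partial>G"] by linarith
qed

section \<open>Lipschitz dependence of the innovation variance on the mixing measure\<close>

text \<open>\<open>u\<^sup>2 / v\<close> is Lipschitz on the cone \<open>|u| \<le> B v\<close>, with constants that do not depend on a lower
  bound for \<open>v\<close>; this makes the estimate summable over all observations \<open>z\<close>.\<close>

lemma abs_diff_square_over_linear_le:
  fixes u v u' v' B :: real
  assumes "0 < v" "0 < v'" "\<bar>u\<bar> \<le> B * v" "\<bar>u'\<bar> \<le> B * v'"
  shows "\<bar>u\<^sup>2 / v - u'\<^sup>2 / v'\<bar> \<le> 2 * B * \<bar>u - u'\<bar> + B\<^sup>2 * \<bar>v - v'\<bar>"
proof -
  \<comment> \<open>In terms of the slopes, x^2 v - x'^2 v' = (x + x') (x v - x' v') - x x' (v - v')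
    holds exactly. The cone condition bounds the slopes by B, and no division by v or v'
    remains.\<close>
  define x x' where "x = u / v" and "x' = u' / v'"
  have u: "u = x * v" "u' = x' * v'" using assms by (auto simp: x_def x'_def)
  have x: "\<bar>x\<bar> \<le> B" "\<bar>x'\<bar> \<le> B"
    using assms by (auto simp: x_def x'_def abs_divide divide_le_eq)
  then have B: "0 \<le> B" by linarith
  have "u\<^sup>2 / v - u'\<^sup>2 / v' = (x + x') * (u - u') - x * x' * (v - v')"
    using assms(1,2) unfolding u by (simp add: field_simps power2_eq_square)
  also have "\<bar>\<dots>\<bar> \<le> \<bar>x + x'\<bar> * \<bar>u - u'\<bar> + (\<bar>x\<bar> * \<bar>x'\<bar>) * \<bar>v - v'\<bar>"
    using abs_triangle_ineq4[of "(x + x') * (u - u')" "x * x' * (v - v')"] by (simp add: abs_mult)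
  also have "\<dots> \<le> 2 * B * \<bar>u - u'\<bar> + B\<^sup>2 * \<bar>v - v'\<bar>"
    unfolding power2_eq_square[of B] using x B abs_triangle_ineq[of x x']
    by (intro add_mono mult_right_mono mult_mono) auto
  finally show ?thesis .
qed

definition mean_dist :: "(real \<Rightarrow> real) \<Rightarrow> real measure \<Rightarrow> real measure \<Rightarrow> real" where
  "mean_dist f G H = \<bar>(\<integral>\<theta>. f \<theta> \<partial>H) - (\<integral>\<theta>. f \<theta> \<partial>G)\<bar>"

lemma mean_dist_nonneg: "0 \<le> mean_dist f G H"
  by (simp add: mean_dist_def)

lemma mean_dist_le: "G \<in> mixing \<Longrightarrow> H \<in> mixing \<Longrightarrow> bounded_on f B \<Longrightarrow> mean_dist f G H \<le> 2 * B"
  using bounded_on_abs_integral_le[of G f B] bounded_on_abs_integral_le[of H f B]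
  by (simp add: mean_dist_def)

text \<open>The right-hand side of \<open>abs_diff_square_over_linear_le\<close> with u =
  \<integral>k_z f and v = \<integral>k_z, where k_z is the likelihood of z.\<close>

definition lipschitz_term :: "(real \<Rightarrow> real) \<Rightarrow> real \<Rightarrow> real measure \<Rightarrow> real measure \<Rightarrow> nat \<Rightarrow> real" where
  "lipschitz_term f B G H z =
     2 * B * mean_dist (\<lambda>\<theta>. likelihood z \<theta> * f \<theta>) G H + B\<^sup>2 * mean_dist (likelihood z) G H"

text \<open>The series of \<open>innovation_var_sums\<close> are compared term by term; the squared
  means account for the extra \<open>2 * B * mean_dist f G H\<close>. The crude bound with 6 = 4 + 2
  is for summability; the rate comes later, from taking expectations along the chain.\<close>

lemma
  assumes f: "bounded_on f B" and B: "0 \<le> B" and G: "G \<in> mixing" and H: "H \<in> mixing"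
  shows lipschitz_term_nonneg: "0 \<le> lipschitz_term f B G H z"
    and lipschitz_term_le: "lipschitz_term f B G H z \<le> 6 * B\<^sup>2 * lik_ub z"
    and innovation_var_lipschitz:
      "\<bar>innovation_var f H - innovation_var f G\<bar>
        \<le> (\<Sum>z. lipschitz_term f B G H z) + 2 * B * mean_dist f G H"
proof -
  show nn: "0 \<le> lipschitz_term f B G H z" for z
    using B by (simp add: lipschitz_term_def mean_dist_nonneg)
  show le: "lipschitz_term f B G H z \<le> 6 * B\<^sup>2 * lik_ub z" for z
  proof -
    have "2 * B * mean_dist (\<lambda>\<theta>. likelihood z \<theta> * f \<theta>) G H \<le> 2 * B * (2 * (lik_ub z * B))"
      using B mean_dist_le[OF G H bounded_on_mult[OF likelihood_bounded_on(1) f]]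
      by (intro mult_left_mono) auto
    moreover have "B\<^sup>2 * mean_dist (likelihood z) G H \<le> B\<^sup>2 * (2 * lik_ub z)"
      using mean_dist_le[OF G H likelihood_bounded_on(1)] by (intro mult_left_mono) auto
    ultimately show ?thesis by (simp add: lipschitz_term_def power2_eq_square algebra_simps)
  qed
  have sum: "summable (lipschitz_term f B G H)"
  proof (rule summable_comparison_test')
    show "summable (\<lambda>z. 6 * B\<^sup>2 * lik_ub z)"
      by (intro summable_mult sums_summable[OF lik_ub_sums])
    show "norm (lipschitz_term f B G H z) \<le> 6 * B\<^sup>2 * lik_ub z" if "0 \<le> z" for z
      using nn[of z] le[of z] by simp
  qed
  let ?u = "\<lambda>H z. \<integral>\<theta>. likelihood z \<theta> * f \<theta> \<partial>H" and ?m = "\<lambda>H. \<integral>\<theta>. f \<theta> \<partial>H"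
  have d: "(\<lambda>z. (?u H z)\<^sup>2 / marginal H z - (?u G z)\<^sup>2 / marginal G z)
      sums (innovation_var f H + (?m H)\<^sup>2 - (innovation_var f G + (?m G)\<^sup>2))" (is "?d sums ?D")
    by (intro sums_diff innovation_var_sums[OF _ f] G H)
  have dl: "\<bar>?d z\<bar> \<le> lipschitz_term f B G H z" for z
    using abs_diff_square_over_linear_le[OF marginal_pos[OF H] marginal_pos[OF G]
        integral_likelihood_abs_le[OF H f] integral_likelihood_abs_le[OF G f], of z]
    by (simp add: lipschitz_term_def mean_dist_def marginal_def)
  have "?D \<le> (\<Sum>z. lipschitz_term f B G H z)"
    by (rule sums_le[OF _ d summable_sums[OF sum]]) (use dl abs_le_D1 in blast)
  moreover have "- ?D \<le> (\<Sum>z. lipschitz_term f B G H z)"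
    by (rule sums_le[OF _ sums_minus[OF d] summable_sums[OF sum]]) (use dl abs_le_D2 in blast)
  moreover have "\<bar>(?m H)\<^sup>2 - (?m G)\<^sup>2\<bar> \<le> 2 * B * mean_dist f G H"
  proof -
    have "\<bar>(?m H)\<^sup>2 - (?m G)\<^sup>2\<bar> = \<bar>?m H + ?m G\<bar> * mean_dist f G H"
      by (simp add: mean_dist_def power2_eq_square square_diff_square_factored flip: abs_mult)
    also have "\<dots> \<le> 2 * B * mean_dist f G H"
      using bounded_on_abs_integral_le[OF G f] bounded_on_abs_integral_le[OF H f]
      by (intro mult_right_mono mean_dist_nonneg) linarith
    finally show ?thesis .
  qed
  ultimately show "\<bar>innovation_var f H - innovation_var f G\<bar>
      \<le> (\<Sum>z. lipschitz_term f B G H z) + 2 * B * mean_dist f G H"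
    by linarith
qed

end

section \<open>The Markov chain of mixing measures\<close>

text \<open>The recursion splits off the first step, so inductions restart from a deterministic
  state with shifted rates; \<open>a 0\<close> is the next rate to be applied. Each step has
  countably many outcomes, so the law is a \<open>pmf\<close> on measures and every functional of
  the state is measurable.\<close>

primrec chain :: "nat \<Rightarrow> (nat \<Rightarrow> real) \<Rightarrow> real measure \<Rightarrow> real measure pmf" where
  "chain 0 a G = return_pmf G"
| "chain (Suc m) a G =
     bind_pmf (predictive G) (\<lambda>z. chain m (\<lambda>j. a (Suc j)) (update (a 0) G z))"

abbreviation rates :: "(nat \<Rightarrow> real) \<Rightarrow> bool" where
  "rates a \<equiv> \<forall>j. 0 \<le> a j \<and> a j \<le> 1"

context mixing_support
begin

lemma chain_mixing: "rates a \<Longrightarrow> G \<in> mixing \<Longrightarrow> H \<in> set_pmf (chain m a G) \<Longrightarrow> H \<in> mixing"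
proof (induction m arbitrary: a G)
  case (Suc m)
  then obtain z where "H \<in> set_pmf (chain m (\<lambda>j. a (Suc j)) (update (a 0) G z))"
    by auto
  with Suc.IH Suc.prems show ?case
    by (metis update_mixing)
qed simp

lemma chain_expectation_step:
  fixes h :: "real measure \<Rightarrow> real"
  assumes "rates a" "G \<in> mixing" "\<And>H. H \<in> mixing \<Longrightarrow> \<bar>h H\<bar> \<le> B"
  shows "measure_pmf.expectation (chain (Suc m) a G) h
    = measure_pmf.expectation (predictive G)
       (\<lambda>z. measure_pmf.expectation (chain m (\<lambda>j. a (Suc j)) (update (a 0) G z)) h)"
  unfolding chain.simps using chain_mixing[OF assms(1,2), of _ "Suc m"] assms(3)
  by (intro expectation_bind_pmf_real[where B = B]) auto

lemma chain_cexpectation_step: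
  fixes h :: "real measure \<Rightarrow> complex"
  assumes "rates a" "G \<in> mixing" "\<And>H. H \<in> mixing \<Longrightarrow> norm (h H) \<le> B"
  shows "measure_pmf.expectation (chain (Suc m) a G) h
    = measure_pmf.expectation (predictive G)
       (\<lambda>z. measure_pmf.expectation (chain m (\<lambda>j. a (Suc j)) (update (a 0) G z)) h)"
  unfolding chain.simps using chain_mixing[OF assms(1,2), of _ "Suc m"] assms(3)
  by (intro expectation_bind_pmf[where B = B]) auto

lemma integrable_chain:
  fixes h :: "real measure \<Rightarrow> 'b::{banach, second_countable_topology}"
  assumes "rates a" "G \<in> mixing" "\<And>H. H \<in> mixing \<Longrightarrow> norm (h H) \<le> B"
  shows "integrable (measure_pmf (chain m a G)) h"
  by (rule integrable_measure_pmf_bounded[where B = B]) (use chain_mixing[OF assms(1,2)] assms(3) in blast)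

text \<open>A single step preserves the mean because the innovation is centred; the induction
  averages this over the first observation.\<close>

lemma chain_mean:
  "rates a \<Longrightarrow> G \<in> mixing \<Longrightarrow> bounded_on f B \<Longrightarrow>
    measure_pmf.expectation (chain m a G) (\<lambda>H. \<integral>\<theta>. f \<theta> \<partial>H) = (\<integral>\<theta>. f \<theta> \<partial>G)"
proof (induction m arbitrary: a G)
  case (Suc m)
  then have a: "0 \<le> a 0" "a 0 \<le> 1" and a': "rates (\<lambda>j. a (Suc j))" by auto
  have "measure_pmf.expectation (chain (Suc m) a G) (\<lambda>H. \<integral>\<theta>. f \<theta> \<partial>H)
    = measure_pmf.expectation (predictive G) (\<lambda>z. \<integral>\<theta>. f \<theta> \<partial>update (a 0) G z)"
    using Suc.prems bounded_on_abs_integral_le[OF _ Suc.prems(3)]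
    by (subst chain_expectation_step[where B = B])
       (auto simp: Suc.IH[OF a' update_mixing[OF Suc.prems(2) a] Suc.prems(3)])
  also have "\<dots> = measure_pmf.expectation (predictive G) (\<lambda>z. (\<integral>\<theta>. f \<theta> \<partial>G) + a 0 * innovation f G z)"
    by (simp add: integral_update[OF Suc.prems(2) a Suc.prems(3)])
  also have "\<dots> = (\<integral>\<theta>. f \<theta> \<partial>G)"
    using integrable_innovation(1)[OF Suc.prems(2,3)] expectation_innovation[OF Suc.prems(2,3)] by simp
  finally show ?case .
qed simp

text \<open>Orthogonality of martingale increments: the squared deviation splits into that of the
  remaining chain and the squared first increment, whose mean is at most
  \<open>B^2 * (a 0)^2\<close>.\<close>

lemma chain_square:
  "rates a \<Longrightarrow> G \<in> mixing \<Longrightarrow> bounded_on f B \<Longrightarrow>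
    measure_pmf.expectation (chain m a G) (\<lambda>H. ((\<integral>\<theta>. f \<theta> \<partial>H) - (\<integral>\<theta>. f \<theta> \<partial>G))\<^sup>2)
      \<le> B\<^sup>2 * (\<Sum>j<m. (a j)\<^sup>2)"
proof (induction m arbitrary: a G)
  case (Suc m)
  note G = Suc.prems(2) and f = Suc.prems(3)
  from Suc.prems have a: "0 \<le> a 0" "a 0 \<le> 1" and a': "rates (\<lambda>j. a (Suc j))" by auto
  let ?m = "\<lambda>H. \<integral>\<theta>. f \<theta> \<partial>H" and ?S = "\<Sum>j<m. (a (Suc j))\<^sup>2"
  let ?C = "\<lambda>z. chain m (\<lambda>j. a (Suc j)) (update (a 0) G z)"
  have B: "\<bar>?m H - c\<bar> \<le> B + \<bar>c\<bar>" if "H \<in> mixing" for H c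
    using bounded_on_abs_integral_le[OF that f] by linarith
  have B2: "\<bar>(?m H - c)\<^sup>2\<bar> \<le> (B + \<bar>c\<bar>)\<^sup>2" if "H \<in> mixing" for H c
    using power_mono[OF B[OF that] abs_ge_zero, of c 2] by simp
  have inner: "measure_pmf.expectation (?C z) (\<lambda>H. (?m H - ?m G)\<^sup>2)
      \<le> B\<^sup>2 * ?S + (a 0)\<^sup>2 * (innovation f G z)\<^sup>2" for z
  proof -
    define G' where "G' = update (a 0) G z"
    have G': "G' \<in> mixing" unfolding G'_def by (rule update_mixing[OF G a])
    have m': "?m G' = ?m G + a 0 * innovation f G z"
      unfolding G'_def by (rule integral_update[OF G a f])
    have i1: "integrable (measure_pmf (?C z)) (\<lambda>H. (?m H - ?m G')\<^sup>2)"
      unfolding G'_def[symmetric] by (rule integrable_chain[OF a' G']) (use B2 in auto)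
    have i2: "integrable (measure_pmf (?C z)) ?m"
      unfolding G'_def[symmetric]
      by (rule integrable_chain[OF a' G', where B = B]) (use bounded_on_abs_integral_le[OF _ f] in auto)
    \<comment> \<open>The square is expanded about the mean after the first step. The cross term is
      affine in \<open>?m H\<close> and vanishes in expectation by
      \<open>chain_mean\<close>.\<close>
    have "measure_pmf.expectation (?C z) (\<lambda>H. (?m H - ?m G)\<^sup>2)
      = measure_pmf.expectation (?C z) (\<lambda>H. (?m H - ?m G')\<^sup>2 + (2 * (?m G' - ?m G) * ?m H
           - (2 * (?m G' - ?m G) * ?m G' - (?m G' - ?m G)\<^sup>2)))"
      by (intro Bochner_Integration.integral_cong) (auto simp: power2_eq_square algebra_simps)
    also have "\<dots> = measure_pmf.expectation (?C z) (\<lambda>H. (?m H - ?m G')\<^sup>2) + (?m G' - ?m G)\<^sup>2"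
      using i1 i2 chain_mean[OF a' G' f, of m] by (simp add: G'_def[symmetric])
    also have "\<dots> \<le> B\<^sup>2 * ?S + (a 0)\<^sup>2 * (innovation f G z)\<^sup>2"
      using Suc.IH[OF a' G' f] by (simp add: G'_def[symmetric] m' power_mult_distrib)
    finally show ?thesis .
  qed
  have "measure_pmf.expectation (chain (Suc m) a G) (\<lambda>H. (?m H - ?m G)\<^sup>2)
    = measure_pmf.expectation (predictive G) (\<lambda>z. measure_pmf.expectation (?C z) (\<lambda>H. (?m H - ?m G)\<^sup>2))"
    by (rule chain_expectation_step[OF Suc.prems(1) G B2])
  also have "\<dots> \<le> measure_pmf.expectation (predictive G) (\<lambda>z. B\<^sup>2 * ?S + (a 0)\<^sup>2 * (innovation f G z)\<^sup>2)"
  proof (rule integral_mono)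
    have "norm (measure_pmf.expectation (?C z) (\<lambda>H. (?m H - ?m G)\<^sup>2)) \<le> (B + \<bar>?m G\<bar>)\<^sup>2" for z
      by (rule norm_expectation_pmf_le)
         (use B2 chain_mixing[OF a' update_mixing[OF G a]] in auto)
    then show "integrable (measure_pmf (predictive G)) (\<lambda>z. measure_pmf.expectation (?C z) (\<lambda>H. (?m H - ?m G)\<^sup>2))"
      by (rule integrable_measure_pmf_bounded)
  qed (use inner integrable_innovation(2)[OF G f] in auto)
  also have "\<dots> = B\<^sup>2 * ?S + (a 0)\<^sup>2 * innovation_var f G"
    using integrable_innovation(2)[OF G f] by (simp add: innovation_var_def)
  also have "\<dots> \<le> B\<^sup>2 * ?S + (a 0)\<^sup>2 * B\<^sup>2"
    using innovation_var_le[OF G f] by (intro add_left_mono mult_left_mono) auto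
  also have "\<dots> = B\<^sup>2 * (\<Sum>j<Suc m. (a j)\<^sup>2)"
    by (simp add: sum.lessThan_Suc_shift algebra_simps del: sum.lessThan_Suc)
  finally show ?case .
qed simp

lemma chain_mean_dist:
  assumes "rates a" "G \<in> mixing" "bounded_on f B" "0 \<le> B"
  shows "measure_pmf.expectation (chain m a G) (mean_dist f G) \<le> B * sqrt (\<Sum>j<m. (a j)\<^sup>2)"
proof -
  have "measure_pmf.expectation (chain m a G) (\<lambda>H. \<bar>(\<integral>\<theta>. f \<theta> \<partial>H) - (\<integral>\<theta>. f \<theta> \<partial>G)\<bar>)
      \<le> sqrt (B\<^sup>2 * (\<Sum>j<m. (a j)\<^sup>2))"
    using mean_dist_le[OF assms(2) chain_mixing[OF assms(1,2)] assms(3), of _ m]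
    by (intro expectation_pmf_abs_le_sqrt[where B = "2 * B"] chain_square[OF assms(1-3)])
       (auto simp: mean_dist_def)
  then show ?thesis
    using assms(4) by (simp add: mean_dist_def[abs_def] real_sqrt_mult)
qed

text \<open>This is what allows the variance to be frozen at the start. Each z contributes 2 + 1 = 3
  times \<open>B^2 * lik_ub z\<close>, which sums to the factor 3 exp R; the summand 2 stems from
  the squared means.\<close>

lemma chain_innovation_var:
  assumes a: "rates a" and G: "G \<in> mixing" and f: "bounded_on f B" and B: "0 \<le> B"
  shows "measure_pmf.expectation (chain m a G) (\<lambda>H. \<bar>innovation_var f H - innovation_var f G\<bar>)
    \<le> (3 * exp R + 2) * B\<^sup>2 * sqrt (\<Sum>j<m. (a j)\<^sup>2)"
proof -
  let ?p = "chain m a G" and ?s = "sqrt (\<Sum>j<m. (a j)\<^sup>2)"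
  let ?E = "measure_pmf.expectation ?p"
  note mix = chain_mixing[OF a G, of _ m]
  note L = lipschitz_term_nonneg[OF f B G] lipschitz_term_le[OF f B G]
  have kf: "bounded_on (\<lambda>\<theta>. likelihood z \<theta> * f \<theta>) (lik_ub z * B)" for z
    by (rule bounded_on_mult[OF likelihood_bounded_on(1) f])
  have imd: "integrable (measure_pmf ?p) (mean_dist g G)" if "bounded_on g C" for g C
    by (rule integrable_chain[OF a G, where B = "2 * C"])
       (use mean_dist_nonneg[of g G] mean_dist_le[OF G _ that] in auto)
  have iL: "integrable (measure_pmf ?p) (\<lambda>H. lipschitz_term f B G H z)" for z
    unfolding lipschitz_term_def using imd[OF kf] imd[OF likelihood_bounded_on(1)] by simp
  have EL: "?E (\<lambda>H. lipschitz_term f B G H z) \<le> 3 * B\<^sup>2 * ?s * lik_ub z" for z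
  proof -
    have "?E (\<lambda>H. lipschitz_term f B G H z)
        = 2 * B * ?E (mean_dist (\<lambda>\<theta>. likelihood z \<theta> * f \<theta>) G) + B\<^sup>2 * ?E (mean_dist (likelihood z) G)"
      unfolding lipschitz_term_def using imd[OF kf] imd[OF likelihood_bounded_on(1)] by simp
    also have "\<dots> \<le> 2 * B * ((lik_ub z * B) * ?s) + B\<^sup>2 * (lik_ub z * ?s)"
      using B lik_ub_nonneg[of z]
      by (intro add_mono mult_left_mono chain_mean_dist[OF a G kf] chain_mean_dist[OF a G likelihood_bounded_on(1)])
         auto
    also have "\<dots> = 3 * B\<^sup>2 * ?s * lik_ub z" by (simp add: power2_eq_square algebra_simps)
    finally show ?thesis .
  qed
  have summ: "summable (\<lambda>z. c * lik_ub z)" for c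
    by (intro summable_mult sums_summable[OF lik_ub_sums])
  have EL_norm: "?E (\<lambda>H. norm (lipschitz_term f B G H z)) = ?E (\<lambda>H. lipschitz_term f B G H z)" for z
    using L(1) mix by (intro integral_cong_AE) (auto simp: AE_measure_pmf_iff)
  have EL0: "0 \<le> ?E (\<lambda>H. lipschitz_term f B G H z)" for z
    unfolding EL_norm[symmetric] by (rule Bochner_Integration.integral_nonneg) auto
  \<comment> \<open>Sum and expectation may be exchanged: the deterministic envelope gives
    convergence for each state, the estimate \<open>EL\<close> gives summability of the
    expectations.\<close>
  have series: "integrable (measure_pmf ?p) (\<lambda>H. \<Sum>z. lipschitz_term f B G H z)"
    "?E (\<lambda>H. \<Sum>z. lipschitz_term f B G H z) = (\<Sum>z. ?E (\<lambda>H. lipschitz_term f B G H z))"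
    "summable (\<lambda>z. ?E (\<lambda>H. lipschitz_term f B G H z))"
  proof -
    have 1: "AE H in measure_pmf ?p. summable (\<lambda>z. norm (lipschitz_term f B G H z))"
      unfolding AE_measure_pmf_iff
      by (intro ballI summable_comparison_test'[OF summ[of "6 * B\<^sup>2"]]) (use L mix in auto)
    have 2: "summable (\<lambda>z. ?E (\<lambda>H. norm (lipschitz_term f B G H z)))"
      unfolding EL_norm
      by (intro summable_comparison_test'[OF summ[of "3 * B\<^sup>2 * ?s"]]) (use EL EL0 in auto)
    show "integrable (measure_pmf ?p) (\<lambda>H. \<Sum>z. lipschitz_term f B G H z)"
      by (rule integrable_suminf[OF iL 1 2])
    show "?E (\<lambda>H. \<Sum>z. lipschitz_term f B G H z) = (\<Sum>z. ?E (\<lambda>H. lipschitz_term f B G H z))"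
      by (rule integral_suminf[OF iL 1 2])
    show "summable (\<lambda>z. ?E (\<lambda>H. lipschitz_term f B G H z))"
      using 2 unfolding EL_norm .
  qed
  have "?E (\<lambda>H. \<bar>innovation_var f H - innovation_var f G\<bar>)
      \<le> ?E (\<lambda>H. (\<Sum>z. lipschitz_term f B G H z) + 2 * B * mean_dist f G H)"
  proof (rule integral_mono_AE)
    have "\<bar>innovation_var f H - innovation_var f G\<bar> \<le> B\<^sup>2" if "H \<in> mixing" for H
      using innovation_var_nonneg[OF that f] innovation_var_le[OF that f]
        innovation_var_nonneg[OF G f] innovation_var_le[OF G f] by linarith
    then show "integrable (measure_pmf ?p) (\<lambda>H. \<bar>innovation_var f H - innovation_var f G\<bar>)"
      by (intro integrable_chain[OF a G, where B = "B\<^sup>2"]) auto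
    show "integrable (measure_pmf ?p) (\<lambda>H. (\<Sum>z. lipschitz_term f B G H z) + 2 * B * mean_dist f G H)"
      using series(1) imd[OF f] by simp
    show "AE H in measure_pmf ?p. \<bar>innovation_var f H - innovation_var f G\<bar>
        \<le> (\<Sum>z. lipschitz_term f B G H z) + 2 * B * mean_dist f G H"
      using innovation_var_lipschitz[OF f B G] mix by (auto simp: AE_measure_pmf_iff)
  qed
  also have "\<dots> = (\<Sum>z. ?E (\<lambda>H. lipschitz_term f B G H z)) + 2 * B * ?E (mean_dist f G)"
    using series(1,2) imd[OF f] by simp
  also have "\<dots> \<le> 3 * B\<^sup>2 * ?s * exp R + 2 * B * (B * ?s)"
    using B
    by (intro add_mono mult_left_mono chain_mean_dist[OF a G f]
          sums_le[OF EL summable_sums[OF series(3)] sums_mult[OF lik_ub_sums]]) auto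
  also have "\<dots> = (3 * exp R + 2) * B\<^sup>2 * ?s"
    by (simp add: power2_eq_square algebra_simps)
  finally show ?thesis .
qed

end

section \<open>Central limit theorem along the chain\<close>

lemma exp_minus_quadratic_bound:
  fixes u :: real
  assumes "0 \<le> u"
  shows "\<bar>exp (- u) - (1 - u)\<bar> \<le> u\<^sup>2 / 2"
proof -
  have "1 - u + u\<^sup>2 / 2 - exp (- u) \<ge> 1 - 0 + 0\<^sup>2 / 2 - exp (- 0)"
  proof (rule DERIV_nonneg_imp_nondecreasing[OF assms])
    fix x :: real
    have "((\<lambda>u. 1 - u + u\<^sup>2 / 2 - exp (- u)) has_real_derivative (- 1 + x + exp (- x))) (at x)"
      by (auto intro!: derivative_eq_intros)
    moreover have "0 \<le> - 1 + x + exp (- x)"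
      using exp_ge_add_one_self[of "- x"] by simp
    ultimately show "\<exists>y. ((\<lambda>u. 1 - u + u\<^sup>2 / 2 - exp (- u)) has_real_derivative y) (at x) \<and> 0 \<le> y"
      by blast
  qed
  then show ?thesis
    using exp_ge_add_one_self[of "- u"] by (simp add: abs_le_iff)
qed

lemma norm_iexp_diff_le: "cmod (iexp x - iexp y) \<le> \<bar>x - y\<bar>"
proof -
  have "iexp x - iexp y = iexp y * (iexp (x - y) - 1)"
    by (simp add: algebra_simps exp_diff)
  then have "cmod (iexp x - iexp y) = cmod (iexp (x - y) - 1)"
    by (simp add: norm_mult)
  also have "\<dots> \<le> \<bar>x - y\<bar>"
    using iexp_approx1[of "x - y" 0] by simp
  finally show ?thesis .
qed

context mixing_support
begin

text \<open>Three errors add up: the cubic Taylor remainder (4/3 = 2^3/6, as innovations are at most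
  2 B), the replacement of the true variance by \<open>v\<close>, and the passage from 1 - u to exp
  (-u) with 1/8 = (1/2)^2/2. The linear term drops out by centring. \<open>v\<close> stays free
  because the chain later uses one value for all its states.\<close>

lemma innovation_iexp_approx:
  assumes G: "G \<in> mixing" and f: "bounded_on f B" and B: "0 \<le> B" and a: "0 \<le> a"
    and v: "0 \<le> v" "v \<le> B\<^sup>2"
  shows "cmod (measure_pmf.expectation (predictive G) (\<lambda>z. iexp (s * (a * innovation f G z)))
      - exp (- (s\<^sup>2 * a\<^sup>2 * v / 2)))
    \<le> 4 / 3 * B ^ 3 * \<bar>s\<bar> ^ 3 * a ^ 3 + s\<^sup>2 / 2 * (a\<^sup>2 * \<bar>innovation_var f G - v\<bar>)
      + B ^ 4 / 8 * s ^ 4 * a ^ 4"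
proof -
  let ?E = "measure_pmf.expectation (predictive G)" and ?x = "\<lambda>z. s * (a * innovation f G z)"
  let ?q = "\<lambda>z. 1 + \<i> * complex_of_real (?x z) - complex_of_real ((?x z)\<^sup>2 / 2)"
  have x: "\<bar>?x z\<bar> \<le> \<bar>s\<bar> * (a * (2 * B))" for z
    using abs_innovation_le[OF G f, of z] a by (auto simp: abs_mult intro!: mult_left_mono)
  note int = integrable_innovation[OF G f, of "predictive G"]
  have iq: "integrable (measure_pmf (predictive G)) (\<lambda>z. complex_of_real (?x z))"
    "integrable (measure_pmf (predictive G)) (\<lambda>z. complex_of_real ((?x z)\<^sup>2 / 2))"
    by (rule integrable_of_real; use int in \<open>simp add: power_mult_distrib\<close>)+
  have ie: "integrable (measure_pmf (predictive G)) (\<lambda>z. iexp (?x z))"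
    by (rule integrable_measure_pmf_bounded[where B = 1]) simp
  have "cmod (iexp y - (1 + \<i> * complex_of_real y - complex_of_real (y\<^sup>2 / 2))) \<le> \<bar>y\<bar> ^ 3 / 6" for y
    using iexp_approx1[of y 2]
    by (simp add: eval_nat_numeral power_mult_distrib algebra_simps)
  then have pt: "cmod (iexp (?x z) - ?q z) \<le> (\<bar>s\<bar> * (a * (2 * B))) ^ 3 / 6" for z
    using power_mono[OF x abs_ge_zero, of z 3] by (meson order_trans divide_right_mono zero_le_numeral)
  have "?E ?q = 1 + \<i> * complex_of_real (s * (a * ?E (innovation f G)))
      - complex_of_real (s\<^sup>2 * a\<^sup>2 * innovation_var f G / 2)"
  proof -
    have "?E ?q = 1 + \<i> * ?E (\<lambda>z. complex_of_real (?x z)) - ?E (\<lambda>z. complex_of_real ((?x z)\<^sup>2 / 2))"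
      using iq by simp
    also have "?E (\<lambda>z. complex_of_real ((?x z)\<^sup>2 / 2)) = complex_of_real (?E (\<lambda>z. (?x z)\<^sup>2 / 2))"
      by (rule integral_complex_of_real)
    also have "?E (\<lambda>z. (?x z)\<^sup>2 / 2) = s\<^sup>2 * a\<^sup>2 * innovation_var f G / 2"
      by (simp add: innovation_var_def power_mult_distrib mult.assoc)
    also have "?E (\<lambda>z. complex_of_real (?x z)) = complex_of_real (?E ?x)"
      by (rule integral_complex_of_real)
    also have "?E ?x = s * (a * ?E (innovation f G))" by simp
    finally show ?thesis .
  qed
  then have "?E (\<lambda>z. iexp (?x z) - ?q z)
      = ?E (\<lambda>z. iexp (?x z)) - complex_of_real (1 - s\<^sup>2 * a\<^sup>2 * innovation_var f G / 2)"
    using iq ie expectation_innovation[OF G f] by simp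
  then have 1: "cmod (?E (\<lambda>z. iexp (?x z)) - complex_of_real (1 - s\<^sup>2 * a\<^sup>2 * innovation_var f G / 2))
      \<le> (\<bar>s\<bar> * (a * (2 * B))) ^ 3 / 6"
    using norm_expectation_pmf_le[of "predictive G" "\<lambda>z. iexp (?x z) - ?q z", OF pt] by simp
  have 2: "cmod (complex_of_real (1 - s\<^sup>2 * a\<^sup>2 * innovation_var f G / 2)
      - complex_of_real (1 - s\<^sup>2 * a\<^sup>2 * v / 2)) = s\<^sup>2 / 2 * (a\<^sup>2 * \<bar>innovation_var f G - v\<bar>)"
  proof -
    have "(1 - s\<^sup>2 * a\<^sup>2 * innovation_var f G / 2) - (1 - s\<^sup>2 * a\<^sup>2 * v / 2)
        = - (s\<^sup>2 / 2 * (a\<^sup>2 * (innovation_var f G - v)))"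
      by (simp add: algebra_simps)
    then show ?thesis
      unfolding of_real_diff[symmetric] norm_of_real by (simp add: abs_mult)
  qed
  have 3: "cmod (complex_of_real (1 - s\<^sup>2 * a\<^sup>2 * v / 2) - exp (- (s\<^sup>2 * a\<^sup>2 * v / 2)))
      \<le> B ^ 4 / 8 * s ^ 4 * a ^ 4"
  proof -
    let ?u = "s\<^sup>2 * a\<^sup>2 * v / 2"
    have "cmod (complex_of_real (1 - ?u) - complex_of_real (exp (- ?u))) = \<bar>exp (- ?u) - (1 - ?u)\<bar>"
      unfolding of_real_diff[symmetric] norm_of_real by simp
    also have "\<dots> \<le> ?u\<^sup>2 / 2"
      using v by (intro exp_minus_quadratic_bound) auto
    also have "\<dots> \<le> (s\<^sup>2 * a\<^sup>2 * B\<^sup>2 / 2)\<^sup>2 / 2"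
      using v by (intro divide_right_mono power_mono mult_left_mono) auto
    also have "\<dots> = B ^ 4 / 8 * s ^ 4 * a ^ 4"
      by (simp add: power_mult_distrib power_divide flip: power_mult)
    finally show ?thesis by simp
  qed
  have 4: "(\<bar>s\<bar> * (a * (2 * B))) ^ 3 / 6 = 4 / 3 * B ^ 3 * \<bar>s\<bar> ^ 3 * a ^ 3"
    by (simp add: power_mult_distrib)
  have tri: "cmod (A - D) \<le> cmod (A - B') + cmod (B' - C) + cmod (C - D)" for A B' C D
    using norm_triangle_ineq[of "A - B'" "B' - D"] norm_triangle_ineq[of "B' - C" "C - D"] by simp
  show ?thesis
    using order_trans[OF tri add_mono[OF add_mono[OF 1 eq_refl[OF 2]] 3]] unfolding 4 by simp
qed

text \<open>Lindeberg replacement along the chain, with the conditional variances replaced by one and the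
  same constant \<open>v\<close>.\<close>

lemma chain_iexp_approx:
  assumes "rates a" "G \<in> mixing" and f: "bounded_on f B" and B: "0 \<le> B" and v: "0 \<le> v" "v \<le> B\<^sup>2"
  shows "cmod (measure_pmf.expectation (chain m a G)
        (\<lambda>H. iexp (s * ((\<integral>\<theta>. f \<theta> \<partial>H) - (\<integral>\<theta>. f \<theta> \<partial>G)))) - exp (- (s\<^sup>2 * (\<Sum>j<m. (a j)\<^sup>2) * v / 2)))
    \<le> (\<Sum>k<m. 4 / 3 * B ^ 3 * \<bar>s\<bar> ^ 3 * a k ^ 3
        + s\<^sup>2 / 2 * ((a k)\<^sup>2 * measure_pmf.expectation (chain k a G) (\<lambda>H. \<bar>innovation_var f H - v\<bar>))
        + B ^ 4 / 8 * s ^ 4 * a k ^ 4)"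
  using assms(1,2)
proof (induction m arbitrary: a G)
  case (Suc m)
  note G = Suc.prems(2)
  define a' where "a' j = a (Suc j)" for j
  from Suc.prems have a: "0 \<le> a 0" "a 0 \<le> 1" and a': "rates a'" by (auto simp: a'_def)
  let ?m = "\<lambda>H. \<integral>\<theta>. f \<theta> \<partial>H" and ?P = "measure_pmf.expectation (predictive G)"
  define U where "U = update (a 0) G"
  define d where "d z = a 0 * innovation f G z" for z
  define T where "T = (\<Sum>j<m. (a' j)\<^sup>2)"
  define err where "err k aa GG = 4 / 3 * B ^ 3 * \<bar>s\<bar> ^ 3 * aa k ^ 3
        + s\<^sup>2 / 2 * ((aa k)\<^sup>2 * measure_pmf.expectation (chain k aa GG) (\<lambda>H. \<bar>innovation_var f H - v\<bar>))
        + B ^ 4 / 8 * s ^ 4 * aa k ^ 4" for k aa GG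
  \<comment> \<open>The characteristic function of the displacement over the last \<open>m\<close>
    steps, seen from the state reached after observing \<open>z\<close>.\<close>
  define \<phi> where "\<phi> z = measure_pmf.expectation (chain m a' (U z)) (\<lambda>H. iexp (s * (?m H - ?m (U z))))" for z
  have U: "U z \<in> mixing" for z unfolding U_def by (rule update_mixing[OF G a])
  have mU: "?m (U z) = ?m G + d z" for z
    unfolding U_def d_def by (rule integral_update[OF G a f])
  have IH: "cmod (\<phi> z - exp (- (s\<^sup>2 * T * v / 2))) \<le> (\<Sum>k<m. err k a' (U z))" for z
    using Suc.IH[OF a' U] by (simp add: \<phi>_def T_def err_def)
  have V: "\<bar>innovation_var f H - v\<bar> \<le> B\<^sup>2" if "H \<in> mixing" for H
    using innovation_var_nonneg[OF that f] innovation_var_le[OF that f] v by linarith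
  have EV: "\<bar>measure_pmf.expectation (chain k a' (U z)) (\<lambda>H. \<bar>innovation_var f H - v\<bar>)\<bar> \<le> B\<^sup>2" for k z
    using norm_expectation_pmf_le[of "chain k a' (U z)" "\<lambda>H. \<bar>innovation_var f H - v\<bar>" "B\<^sup>2"]
      V chain_mixing[OF a' U] by auto
  have int_EV: "integrable (measure_pmf (predictive G))
      (\<lambda>z. measure_pmf.expectation (chain k a' (U z)) (\<lambda>H. \<bar>innovation_var f H - v\<bar>))" for k
    by (rule integrable_measure_pmf_bounded[where B = "B\<^sup>2"]) (use EV in simp)
  \<comment> \<open>Averaging over the first observation turns the k-th error of the shorter chain
    into the error with index k + 1 of the longer one, by the Chapman-Kolmogorov relation.\<close>
  have Perr: "?P (\<lambda>z. err k a' (U z)) = err (Suc k) a G" for k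
  proof -
    have "measure_pmf.expectation (chain (Suc k) a G) (\<lambda>H. \<bar>innovation_var f H - v\<bar>)
      = ?P (\<lambda>z. measure_pmf.expectation (chain k a' (U z)) (\<lambda>H. \<bar>innovation_var f H - v\<bar>))"
      unfolding U_def a'_def[abs_def]
      by (rule chain_expectation_step[OF Suc.prems, where B = "B\<^sup>2"]) (use V in auto)
    then show ?thesis
      using int_EV by (simp add: err_def a'_def)
  qed
  have \<phi>_le: "cmod (\<phi> z) \<le> 1" for z
    unfolding \<phi>_def by (rule norm_expectation_pmf_le) simp
  have E: "measure_pmf.expectation (chain (Suc m) a G) (\<lambda>H. iexp (s * (?m H - ?m G)))
      = ?P (\<lambda>z. iexp (s * d z) * \<phi> z)"
  proof -
    have "measure_pmf.expectation (chain (Suc m) a G) (\<lambda>H. iexp (s * (?m H - ?m G)))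
      = ?P (\<lambda>z. measure_pmf.expectation (chain m a' (U z)) (\<lambda>H. iexp (s * (?m H - ?m G))))"
      unfolding U_def a'_def[abs_def]
      by (rule chain_cexpectation_step[OF Suc.prems, where B = 1]) simp
    also have "(\<lambda>z. measure_pmf.expectation (chain m a' (U z)) (\<lambda>H. iexp (s * (?m H - ?m G))))
      = (\<lambda>z. iexp (s * d z) * \<phi> z)"
    proof
      fix z
      have "iexp (s * (?m H - ?m G)) = iexp (s * d z) * iexp (s * (?m H - ?m (U z)))" for H
        unfolding mU by (simp add: algebra_simps flip: exp_add)
      then show "measure_pmf.expectation (chain m a' (U z)) (\<lambda>H. iexp (s * (?m H - ?m G)))
          = iexp (s * d z) * \<phi> z"
        unfolding \<phi>_def by simp
    qed
    finally show ?thesis .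
  qed
  let ?e = "\<lambda>S. complex_of_real (exp (- (s\<^sup>2 * S * v / 2)))"
  have 1: "cmod (?P (\<lambda>z. iexp (s * d z) * (\<phi> z - ?e T))) \<le> (\<Sum>k<m. err (Suc k) a G)"
  proof -
    have "cmod (?P (\<lambda>z. iexp (s * d z) * (\<phi> z - ?e T)))
        \<le> ?P (\<lambda>z. cmod (iexp (s * d z) * (\<phi> z - ?e T)))"
      by (rule integral_norm_bound)
    also have "\<dots> \<le> ?P (\<lambda>z. \<Sum>k<m. err k a' (U z))"
    proof (rule integral_mono)
      have "cmod (\<phi> z - ?e T) \<le> 1 + cmod (?e T)" for z
        using norm_triangle_ineq4[of "\<phi> z" "?e T"] \<phi>_le[of z] by linarith
      then show "integrable (measure_pmf (predictive G)) (\<lambda>z. cmod (iexp (s * d z) * (\<phi> z - ?e T)))"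
        by (intro integrable_measure_pmf_bounded[where B = "1 + cmod (?e T)"]) (simp add: norm_mult)
      show "integrable (measure_pmf (predictive G)) (\<lambda>z. \<Sum>k<m. err k a' (U z))"
        using int_EV by (auto simp: err_def)
      show "cmod (iexp (s * d z) * (\<phi> z - ?e T)) \<le> (\<Sum>k<m. err k a' (U z))" for z
        using IH[of z] by (simp add: norm_mult exp_of_real)
    qed
    also have "\<dots> = (\<Sum>k<m. ?P (\<lambda>z. err k a' (U z)))"
      using int_EV by (intro Bochner_Integration.integral_sum) (auto simp: err_def)
    finally show ?thesis by (simp add: Perr)
  qed
  have 2: "cmod (?P (\<lambda>z. iexp (s * d z)) - ?e ((a 0)\<^sup>2)) \<le> err 0 a G"
    using innovation_iexp_approx[OF G f B a(1) v, of s] by (simp add: d_def err_def exp_of_real)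
  have iphi: "integrable (measure_pmf (predictive G)) (\<lambda>z. iexp (s * d z) * \<phi> z)"
    by (rule integrable_measure_pmf_bounded[where B = 1]) (simp add: norm_mult \<phi>_le)
  have iexp: "integrable (measure_pmf (predictive G)) (\<lambda>z. iexp (s * d z))"
    by (rule integrable_measure_pmf_bounded[where B = 1]) simp
  have "?P (\<lambda>z. iexp (s * d z) * (\<phi> z - ?e T)) = ?P (\<lambda>z. iexp (s * d z) * \<phi> z) - ?P (\<lambda>z. iexp (s * d z)) * ?e T"
    using iphi iexp by (simp add: right_diff_distrib)
  moreover have "?e ((a 0)\<^sup>2 + T) = ?e ((a 0)\<^sup>2) * ?e T"
    unfolding of_real_mult[symmetric] exp_add[symmetric] by (simp add: algebra_simps add_divide_distrib)
  \<comment> \<open>The Gaussian factor for the remaining steps does not depend on \<open>z\<close>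
    and can leave the expectation. This is the point of using a constant \<open>v\<close>; the
    factor has modulus at most 1 because \<open>v\<close> is nonnegative.\<close>
  ultimately have split: "?P (\<lambda>z. iexp (s * d z) * \<phi> z) - ?e ((a 0)\<^sup>2 + T)
      = ?P (\<lambda>z. iexp (s * d z) * (\<phi> z - ?e T)) + (?P (\<lambda>z. iexp (s * d z)) - ?e ((a 0)\<^sup>2)) * ?e T"
    by (simp add: algebra_simps)
  have 3: "cmod ((?P (\<lambda>z. iexp (s * d z)) - ?e ((a 0)\<^sup>2)) * ?e T) \<le> err 0 a G"
  proof -
    have "0 \<le> s\<^sup>2 * T * v / 2"
      using v by (auto simp: T_def intro!: mult_nonneg_nonneg sum_nonneg)
    then have "cmod (?e T) \<le> 1" by simp
    then show ?thesis
      using mult_mono[OF 2 \<open>cmod (?e T) \<le> 1\<close> order_trans[OF norm_ge_zero 2]] by (simp add: norm_mult)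
  qed
  have "cmod (?P (\<lambda>z. iexp (s * d z) * \<phi> z) - ?e ((a 0)\<^sup>2 + T))
      \<le> (\<Sum>k<m. err (Suc k) a G) + err 0 a G"
    unfolding split by (rule norm_triangle_le[OF add_mono[OF 1 3]])
  moreover have "(\<Sum>j<Suc m. (a j)\<^sup>2) = (a 0)\<^sup>2 + T"
    by (simp add: T_def a'_def sum.lessThan_Suc_shift del: sum.lessThan_Suc)
  moreover have "(\<Sum>k<Suc m. err k a G) = (\<Sum>k<m. err (Suc k) a G) + err 0 a G"
    by (simp add: sum.lessThan_Suc_shift del: sum.lessThan_Suc)
  ultimately show ?case
    unfolding E err_def[symmetric] by simp
qed simp

lemma chain_clt:
  assumes a: "rates a" and a_le: "\<And>j. a j \<le> c" and G: "G \<in> mixing" and f: "bounded_on f B" and B: "0 \<le> B"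
    and S: "S = (\<Sum>j<m. (a j)\<^sup>2)"
  shows "cmod (measure_pmf.expectation (chain m a G)
        (\<lambda>H. iexp (s * ((\<integral>\<theta>. f \<theta> \<partial>H) - (\<integral>\<theta>. f \<theta> \<partial>G)))) - exp (- (s\<^sup>2 * S * innovation_var f G / 2)))
    \<le> 4 / 3 * B ^ 3 * \<bar>s\<bar> ^ 3 * c * S + (3 * exp R + 2) * B\<^sup>2 / 2 * s\<^sup>2 * sqrt S * S
      + B ^ 4 / 8 * s ^ 4 * c\<^sup>2 * S"
proof -
  let ?K = "(3 * exp R + 2) * B\<^sup>2"
  have a0: "0 \<le> a j" for j using a by simp
  have c0: "0 \<le> c" using a0[of 0] a_le[of 0] by linarith
  have "cmod (measure_pmf.expectation (chain m a G)
        (\<lambda>H. iexp (s * ((\<integral>\<theta>. f \<theta> \<partial>H) - (\<integral>\<theta>. f \<theta> \<partial>G)))) - exp (- (s\<^sup>2 * S * innovation_var f G / 2)))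
    \<le> (\<Sum>k<m. 4 / 3 * B ^ 3 * \<bar>s\<bar> ^ 3 * a k ^ 3
        + s\<^sup>2 / 2 * ((a k)\<^sup>2 * measure_pmf.expectation (chain k a G)
            (\<lambda>H. \<bar>innovation_var f H - innovation_var f G\<bar>))
        + B ^ 4 / 8 * s ^ 4 * a k ^ 4)"
    unfolding S
    by (rule chain_iexp_approx[OF a G f B innovation_var_nonneg[OF G f] innovation_var_le[OF G f]])
  also have "\<dots> \<le> (\<Sum>k<m. 4 / 3 * B ^ 3 * \<bar>s\<bar> ^ 3 * (c * (a k)\<^sup>2)
        + s\<^sup>2 / 2 * ((a k)\<^sup>2 * (?K * sqrt S)) + B ^ 4 / 8 * s ^ 4 * (c\<^sup>2 * (a k)\<^sup>2))"
  proof (intro sum_mono add_mono mult_left_mono)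
    fix k assume "k \<in> {..<m}"
    then have "(\<Sum>j<k. (a j)\<^sup>2) \<le> S"
      unfolding S by (intro sum_mono2) auto
    then have "?K * sqrt (\<Sum>j<k. (a j)\<^sup>2) \<le> ?K * sqrt S"
      by (intro mult_left_mono) (auto intro!: mult_nonneg_nonneg add_nonneg_nonneg)
    then show "measure_pmf.expectation (chain k a G) (\<lambda>H. \<bar>innovation_var f H - innovation_var f G\<bar>)
        \<le> ?K * sqrt S"
      using chain_innovation_var[OF a G f B, of k] by linarith
    show "a k ^ 3 \<le> c * (a k)\<^sup>2"
      using mult_right_mono[OF a_le[of k], of "(a k)\<^sup>2"] by (simp add: eval_nat_numeral)
    have "(a k)\<^sup>2 \<le> c\<^sup>2" by (rule power_mono[OF a_le a0])
    then show "a k ^ 4 \<le> c\<^sup>2 * (a k)\<^sup>2"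
      using mult_right_mono[of "(a k)\<^sup>2" "c\<^sup>2" "(a k)\<^sup>2"] by (simp add: eval_nat_numeral)
  qed (use B in auto)
  also have "\<dots> = 4 / 3 * B ^ 3 * \<bar>s\<bar> ^ 3 * c * S + ?K / 2 * s\<^sup>2 * sqrt S * S + B ^ 4 / 8 * s ^ 4 * c\<^sup>2 * S"
    unfolding S by (simp add: sum.distrib sum_distrib_left sum_distrib_right sum_divide_distrib algebra_simps)
  finally show ?thesis .
qed

section \<open>Linearisation of the estimator\<close>

text \<open>The differential of (p, q) \<mapsto> (y + 1) q / p at the two marginals of
  \<open>G\<close>: the partial derivatives are est/q and -est/p, each multiplied by the likelihood
  whose integral is the corresponding marginal. Its mean under \<open>G\<close> is 0.\<close>

definition est_gradient :: "real measure \<Rightarrow> nat \<Rightarrow> real \<Rightarrow> real" where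
  "est_gradient G y \<theta> = bayes_est G y / marginal G (y + 1) * likelihood (y + 1) \<theta>
     - bayes_est G y / marginal G y * likelihood y \<theta>"

text \<open>Obtained from marginals at most 1 in numerators and at least \<open>lik_lb\<close> in
  denominators; it is the same for all mixing measures, hence for every G_n.\<close>

definition est_gradient_bound :: "nat \<Rightarrow> real" where
  "est_gradient_bound y = (real y + 1) / lik_lb y * (1 / lik_lb (y + 1) + 1 / lik_lb y)"

lemma est_gradient_bound_nonneg: "0 \<le> est_gradient_bound y"
  using lik_lb_pos by (simp add: est_gradient_bound_def less_imp_le)

lemma
  assumes G: "G \<in> mixing"
  shows bayes_est_nonneg: "0 \<le> bayes_est G y" and bayes_est_le: "bayes_est G y \<le> (real y + 1) / lik_lb y"
proof -
  show "0 \<le> bayes_est G y"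
    using marginal_pos[OF G] by (simp add: bayes_est_def less_imp_le)
  show "bayes_est G y \<le> (real y + 1) / lik_lb y"
    unfolding bayes_est_def using marginal_le_1[OF G, of "y + 1"] marginal_ge[OF G, of y] lik_lb_pos[of y]
    by (intro frac_le) (auto simp: mult_le_cancel_left1)
qed

lemma est_gradient_bounded_on:
  assumes G: "G \<in> mixing"
  shows "bounded_on (est_gradient G y) (est_gradient_bound y)"
proof -
  have c: "\<bar>bayes_est G y / marginal G z\<bar> \<le> (real y + 1) / lik_lb y * (1 / lik_lb z)" for z
    using bayes_est_nonneg[OF G, of y] bayes_est_le[OF G, of y] marginal_ge[OF G, of z] lik_lb_pos[of z]
      marginal_pos[OF G, of z] frac_le[of "(real y + 1) / lik_lb y" "bayes_est G y" "lik_lb z" "marginal G z"]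
    by simp
  have "bounded_on (est_gradient G y)
      (\<bar>bayes_est G y / marginal G (y + 1)\<bar> * 1 + \<bar>bayes_est G y / marginal G y\<bar> * 1)"
    unfolding est_gradient_def
    by (intro bounded_on_diff bounded_on_cmult likelihood_bounded_on)
  moreover have "\<bar>bayes_est G y / marginal G (y + 1)\<bar> * 1 + \<bar>bayes_est G y / marginal G y\<bar> * 1
      \<le> est_gradient_bound y"
    using c[of "y + 1"] c[of y] by (simp add: est_gradient_bound_def algebra_simps)
  ultimately show ?thesis by force
qed

lemma integral_est_gradient:
  assumes G: "G \<in> mixing" and H: "H \<in> mixing"
  shows "(\<integral>\<theta>. est_gradient G y \<theta> \<partial>H)
    = bayes_est G y / marginal G (y + 1) * marginal H (y + 1) - bayes_est G y / marginal G y * marginal H y"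
  using bounded_on_integrable[OF H likelihood_bounded_on(1)]
  by (simp add: est_gradient_def marginal_def)

lemma marginal_posterior_le: "G \<in> mixing \<Longrightarrow> marginal (posterior G z) y \<le> 1"
  by (rule marginal_le_1[OF posterior_mixing])

text \<open>The innovation of the gradient is the estimator times the difference of the two marginal
  ratios, up to a sign that the square removes; the predictive weights are the marginals.\<close>

lemma limit_variance_eq_innovation_var:
  assumes G: "G \<in> mixing"
  shows "limit_variance G y = innovation_var (est_gradient G y) G"
proof -
  let ?f = "est_gradient G y"
  let ?t = "\<lambda>z. marginal G z * (marginal (posterior G z) y / marginal G y
         - marginal (posterior G z) (y + 1) / marginal G (y + 1))\<^sup>2"
  note f = est_gradient_bounded_on[OF G, of y]
  have eq: "pmf (predictive G) z *\<^sub>R (innovation ?f G z)\<^sup>2 = (bayes_est G y)\<^sup>2 * ?t z" for z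
  proof -
    have "innovation ?f G z = bayes_est G y * (marginal (posterior G z) (y + 1) / marginal G (y + 1)
        - marginal (posterior G z) y / marginal G y)"
      using marginal_pos[OF G]
      by (simp add: innovation_def integral_est_gradient[OF G] posterior_mixing[OF G] G less_imp_neq[symmetric]
          algebra_simps)
    then show ?thesis
      by (simp add: pmf_predictive[OF G] power_mult_distrib power2_commute)
  qed
  have "(\<lambda>z. (bayes_est G y)\<^sup>2 * ?t z) sums innovation_var ?f G"
    using sums_expectation_pmf_nat[OF integrable_innovation(2)[OF G f], of "predictive G"]
    unfolding eq innovation_var_def .
  \<comment> \<open>Dividing by the squared estimator recovers convergence of the bare series, which
    occurs in \<open>limit_variance\<close> under \<open>suminf\<close>.\<close>
  moreover have "bayes_est G y \<noteq> 0"
    using marginal_pos[OF G, of y] marginal_pos[OF G, of "y + 1"] by (simp add: bayes_est_def)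
  ultimately have "?t sums (innovation_var ?f G / (bayes_est G y)\<^sup>2)"
    using sums_divide[of _ _ "(bayes_est G y)\<^sup>2"] by fastforce
  then show ?thesis
    using \<open>bayes_est G y \<noteq> 0\<close> by (simp add: limit_variance_def sums_iff)
qed

text \<open>The cube bounds the denominator p^2 p' of the exact remainder from below; the 2 comes
  from D (D + E) \<le> 2 (D^2 + E^2).\<close>

definition est_remainder_const :: "nat \<Rightarrow> real" where
  "est_remainder_const y = 2 * (real y + 1) / lik_lb y ^ 3"

lemma est_remainder_const_nonneg: "0 \<le> est_remainder_const y"
  using lik_lb_pos by (simp add: est_remainder_const_def less_imp_le)

lemma bayes_est_linearization:
  assumes G: "G \<in> mixing" and H: "H \<in> mixing"
  shows "\<bar>(bayes_est H y - bayes_est G y)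
      - ((\<integral>\<theta>. est_gradient G y \<theta> \<partial>H) - (\<integral>\<theta>. est_gradient G y \<theta> \<partial>G))\<bar>
    \<le> est_remainder_const y * ((marginal H y - marginal G y)\<^sup>2 + (marginal H (y + 1) - marginal G (y + 1))\<^sup>2)"
proof -
  define p q p' q' c where "p = marginal G y" and "q = marginal G (y + 1)"
    and "p' = marginal H y" and "q' = marginal H (y + 1)" and "c = lik_lb y"
  have pos: "0 < p" "0 < q" "0 < p'" "0 < q'" "0 < c"
    unfolding p_def q_def p'_def q'_def c_def by (rule marginal_pos[OF G] marginal_pos[OF H] lik_lb_pos)+
  have le: "p \<le> 1" "q \<le> 1" "c \<le> p" "c \<le> p'"
    unfolding p_def q_def p'_def q'_def c_def
    by (rule marginal_le_1[OF G] marginal_ge[OF G] marginal_ge[OF H])+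
  let ?D = "\<bar>p' - p\<bar>" and ?E = "\<bar>q' - q\<bar>"
  \<comment> \<open>The Taylor remainder of the quotient q / p in closed form: the product of
    differences in the numerator shows that it is quadratic, without any second derivatives.\<close>
  have "(bayes_est H y - bayes_est G y)
      - ((\<integral>\<theta>. est_gradient G y \<theta> \<partial>H) - (\<integral>\<theta>. est_gradient G y \<theta> \<partial>G))
    = (real y + 1) * ((p' - p) * (q * (p' - p) - p * (q' - q)) / (p\<^sup>2 * p'))"
    using pos unfolding integral_est_gradient[OF G G] integral_est_gradient[OF G H] bayes_est_def
      p_def[symmetric] q_def[symmetric] p'_def[symmetric] q'_def[symmetric]
    by (simp add: field_simps power2_eq_square)
  also have "\<bar>\<dots>\<bar> = (real y + 1) * (?D * \<bar>q * (p' - p) - p * (q' - q)\<bar> / (p\<^sup>2 * p'))"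
    using pos by (simp add: abs_mult abs_divide)
  also have "\<dots> \<le> (real y + 1) * (?D * (?D + ?E) / c ^ 3)"
  proof (intro mult_left_mono frac_le)
    have "\<bar>q * (p' - p) - p * (q' - q)\<bar> \<le> q * ?D + p * ?E"
      using abs_triangle_ineq4[of "q * (p' - p)" "p * (q' - q)"] pos by (simp add: abs_mult)
    also have "\<dots> \<le> 1 * ?D + 1 * ?E"
      using le by (intro add_mono mult_right_mono) auto
    finally show "\<bar>q * (p' - p) - p * (q' - q)\<bar> \<le> ?D + ?E" by simp
    have "c\<^sup>2 * c \<le> p\<^sup>2 * p'"
      using pos le by (intro mult_mono power_mono) auto
    then show "c ^ 3 \<le> p\<^sup>2 * p'" by (simp add: eval_nat_numeral mult.assoc)
  qed (use pos in auto)
  also have "\<dots> \<le> (real y + 1) * (2 * (?D\<^sup>2 + ?E\<^sup>2) / c ^ 3)"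
  proof (intro mult_left_mono divide_right_mono)
    have "0 \<le> (?D - ?E)\<^sup>2" "0 \<le> ?D\<^sup>2" "0 \<le> ?E\<^sup>2" by simp_all
    then show "?D * (?D + ?E) \<le> 2 * (?D\<^sup>2 + ?E\<^sup>2)"
      unfolding power2_diff by (simp only: power2_eq_square algebra_simps)
  qed (use pos in auto)
  also have "\<dots> = est_remainder_const y * ((p' - p)\<^sup>2 + (q' - q)\<^sup>2)"
    by (simp add: est_remainder_const_def c_def algebra_simps)
  finally show ?thesis
    unfolding p_def q_def p'_def q'_def .
qed

text \<open>The first summand is the cost of linearisation, the bracket is the bound of
  \<open>chain_clt\<close> for the gradient. No quantity here depends on the initial
  measure.\<close>

definition clt_error :: "nat \<Rightarrow> real \<Rightarrow> real \<Rightarrow> real \<Rightarrow> real" where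
  "clt_error y c S s = 2 * est_remainder_const y * \<bar>s\<bar> * S
     + (4 / 3 * est_gradient_bound y ^ 3 * \<bar>s\<bar> ^ 3 * c * S
        + (3 * exp R + 2) * (est_gradient_bound y)\<^sup>2 / 2 * s\<^sup>2 * sqrt S * S
        + est_gradient_bound y ^ 4 / 8 * s ^ 4 * c\<^sup>2 * S)"

text \<open>Exponentials of imaginary arguments are 1-Lipschitz, so the quadratic remainder costs a
  multiple of |s| times two second moments, each at most \<open>S\<close> by
  \<open>chain_square\<close> with bound 1. For s of order S^(-1/2) this is still of order
  S^(1/2).\<close>

lemma chain_bayes_est_clt:
  assumes a: "rates a" and a_le: "\<And>j. a j \<le> c" and G: "G \<in> mixing" and S: "S = (\<Sum>j<m. (a j)\<^sup>2)"
  shows "cmod (measure_pmf.expectation (chain m a G) (\<lambda>H. iexp (s * (bayes_est H y - bayes_est G y)))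
      - exp (- (s\<^sup>2 * S * limit_variance G y / 2))) \<le> clt_error y c S s"
proof -
  let ?E = "measure_pmf.expectation (chain m a G)" and ?f = "est_gradient G y"
  let ?lin = "\<lambda>H. (\<integral>\<theta>. ?f \<theta> \<partial>H) - (\<integral>\<theta>. ?f \<theta> \<partial>G)"
  let ?sq = "\<lambda>z H. (marginal H z - marginal G z)\<^sup>2" and ?C = "est_remainder_const y"
  note f = est_gradient_bounded_on[OF G, of y]
  have abs_marginal_diff_le: "\<bar>marginal H z - marginal G z\<bar> \<le> 1" if "H \<in> mixing" for H z
    using marginal_le_1[OF G, of z] marginal_pos[OF G, of z] marginal_le_1[OF that, of z]
      marginal_pos[OF that, of z] by linarith
  have i: "integrable (measure_pmf (chain m a G)) (?sq z)" for z
    by (rule integrable_chain[OF a G, where B = "1"])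
       (use abs_marginal_diff_le in \<open>simp add: abs_square_le_1\<close>)
  have ie: "integrable (measure_pmf (chain m a G)) (\<lambda>H. iexp (s * h H))" for h
    by (rule integrable_chain[OF a G, where B = 1]) simp
  have sq: "?E (?sq z) \<le> S" for z
    using chain_square[OF a G likelihood_bounded_on(2)[of z], of m] by (simp add: S marginal_def)
  have "?E (\<lambda>H. iexp (s * (bayes_est H y - bayes_est G y))) - ?E (\<lambda>H. iexp (s * ?lin H))
      = ?E (\<lambda>H. iexp (s * (bayes_est H y - bayes_est G y)) - iexp (s * ?lin H))"
    by (rule Bochner_Integration.integral_diff[symmetric]) (rule ie)+
  also have "cmod \<dots> \<le> ?E (\<lambda>H. cmod (iexp (s * (bayes_est H y - bayes_est G y)) - iexp (s * ?lin H)))"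
    by (rule integral_norm_bound)
  also have "\<dots> \<le> ?E (\<lambda>H. \<bar>s\<bar> * (?C * (?sq y H + ?sq (y + 1) H)))"
  proof (rule integral_mono_AE)
    show "AE H in measure_pmf (chain m a G).
        cmod (iexp (s * (bayes_est H y - bayes_est G y)) - iexp (s * ?lin H))
          \<le> \<bar>s\<bar> * (?C * (?sq y H + ?sq (y + 1) H))"
      unfolding AE_measure_pmf_iff
    proof
      fix H assume "H \<in> set_pmf (chain m a G)"
      then have H: "H \<in> mixing" by (rule chain_mixing[OF a G])
      have "cmod (iexp (s * (bayes_est H y - bayes_est G y)) - iexp (s * ?lin H))
          \<le> \<bar>s\<bar> * \<bar>(bayes_est H y - bayes_est G y) - ?lin H\<bar>"
        using norm_iexp_diff_le[of "s * (bayes_est H y - bayes_est G y)" "s * ?lin H"]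
        by (simp flip: right_diff_distrib abs_mult)
      also have "\<dots> \<le> \<bar>s\<bar> * (?C * (?sq y H + ?sq (y + 1) H))"
        by (intro mult_left_mono bayes_est_linearization[OF G H]) simp
      finally show "cmod (iexp (s * (bayes_est H y - bayes_est G y)) - iexp (s * ?lin H))
          \<le> \<bar>s\<bar> * (?C * (?sq y H + ?sq (y + 1) H))" .
    qed
    show "integrable (measure_pmf (chain m a G))
        (\<lambda>H. cmod (iexp (s * (bayes_est H y - bayes_est G y)) - iexp (s * ?lin H)))"
      by (rule integrable_norm[OF Bochner_Integration.integrable_diff[OF ie ie]])
  qed (use i in simp)
  also have "\<dots> = \<bar>s\<bar> * (?C * (?E (?sq y) + ?E (?sq (y + 1))))"
    using i by simp
  also have "\<dots> \<le> \<bar>s\<bar> * (?C * (S + S))"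
    by (intro mult_left_mono add_mono sq est_remainder_const_nonneg) simp
  finally have 1: "cmod (?E (\<lambda>H. iexp (s * (bayes_est H y - bayes_est G y))) - ?E (\<lambda>H. iexp (s * ?lin H)))
      \<le> 2 * ?C * \<bar>s\<bar> * S" by (simp add: algebra_simps)
  note 2 = chain_clt[OF a a_le G f est_gradient_bound_nonneg S, of s]
  show ?thesis
    using norm_triangle_le[OF add_mono[OF 1 2]]
    by (simp add: clt_error_def limit_variance_eq_innovation_var[OF G])
qed

end

section \<open>Conditioning on the observed path\<close>

text \<open>For positive \<open>v\<close> the law is the image of the standard normal under
  multiplication by \<open>sqrt v\<close>; the Dirac case fits the same formula for the
  characteristic function.\<close>

lemma
  assumes "0 \<le> v"
  shows real_distribution_centered_gaussian: "real_distribution (centered_gaussian v)"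
    and char_centered_gaussian: "char (centered_gaussian v) t = exp (- (t\<^sup>2 * v / 2))"
proof -
  have "real_distribution (centered_gaussian v) \<and> char (centered_gaussian v) t = exp (- (t\<^sup>2 * v / 2))"
  proof (cases "v = 0")
    case True
    have "real_distribution (return borel (0 :: real))"
      unfolding real_distribution_def real_distribution_axioms_def by (simp add: prob_space_return)
    then show ?thesis
      using True by (simp add: centered_gaussian_def char_def integral_return)
  next
    case False
    then have v: "0 < sqrt v" using assms by simp
    interpret std: real_distribution std_normal_distribution
      by (rule real_dist_normal_dist)
    have "distributed std_normal_distribution lborel (\<lambda>x. x) (normal_density 0 1)"
      by (simp add: distributed_def distr_id2)
    from std.normal_density_affine[OF this, of "sqrt v" 0] v
    have "distributed std_normal_distribution lborel (\<lambda>x. sqrt v * x) (normal_density 0 (sqrt v))"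
      by simp
    then have eq: "centered_gaussian v = distr std_normal_distribution lborel (\<lambda>x. sqrt v * x)"
      using False by (simp add: distributed_def centered_gaussian_def)
    have "prob_space (centered_gaussian v)"
      unfolding eq by (rule std.prob_space_distr) simp
    moreover have "char (centered_gaussian v) t = char std_normal_distribution (t * sqrt v)"
      unfolding eq char_def by (subst integral_distr) (auto simp: mult.assoc)
    moreover have "(t * sqrt v)\<^sup>2 = t\<^sup>2 * v"
      using assms by (simp add: power_mult_distrib)
    ultimately show ?thesis
      by (simp only: char_std_normal_distribution real_distribution_def real_distribution_axioms_def)
         (simp add: eq)
  qed
  then show "real_distribution (centered_gaussian v)"
    "char (centered_gaussian v) t = exp (- (t\<^sup>2 * v / 2))" by auto
qed

lemma integral_uniform_measure:
  fixes f :: "'a \<Rightarrow> 'b::{banach, second_countable_topology}"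
  assumes A: "A \<in> sets M" "emeasure M A \<noteq> 0" "emeasure M A \<noteq> \<infinity>" and f: "f \<in> borel_measurable M"
  shows "(\<integral>x. f x \<partial>uniform_measure M A) = (\<integral>x. indicator A x *\<^sub>R f x \<partial>M) /\<^sub>R measure M A"
proof -
  have pos: "0 < measure M A"
    using A by (simp add: measure_def enn2real_positive_iff less_top[symmetric] zero_less_iff_neq_zero)
  have em: "emeasure M A = ennreal (measure M A)"
    using A by (intro emeasure_eq_ennreal_measure) auto
  have "uniform_measure M A = density M (\<lambda>x. ennreal (indicator A x / measure M A))"
    unfolding uniform_measure_def em using pos divide_ennreal[of 1 "measure M A"]
    by (intro arg_cong[where f = "density M"] ext) (auto split: split_indicator)
  also have "(\<integral>x. f x \<partial>\<dots>) = (\<integral>x. (indicator A x / measure M A) *\<^sub>R f x \<partial>M)"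
    using f A(1) by (intro integral_density) auto
  also have "\<dots> = (\<integral>x. (1 / measure M A) *\<^sub>R (indicator A x *\<^sub>R f x) \<partial>M)"
    by (intro Bochner_Integration.integral_cong) auto
  also have "\<dots> = (1 / measure M A) *\<^sub>R (\<integral>x. indicator A x *\<^sub>R f x \<partial>M)"
    by (rule integral_scaleR_right)
  finally show ?thesis
    by (simp add: divide_inverse)
qed

text \<open>The default on null atoms makes the kernel a probability measure at every point, as
  measurability into \<open>prob_algebra\<close> requires.\<close>

definition atom_distr :: "'a measure \<Rightarrow> ('a \<Rightarrow> real) \<Rightarrow> 'a set \<Rightarrow> real measure" where
  "atom_distr M X A = (if measure M A = 0 then return borel 0 else distr (uniform_measure M A) borel X)"

context prob_space
begin

lemma real_distribution_atom_distr:
  assumes "random_variable borel X"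
  shows "real_distribution (atom_distr M X A)"
proof (cases "measure M A = 0")
  case True
  then show ?thesis
    unfolding real_distribution_def real_distribution_axioms_def
    by (simp add: atom_distr_def prob_space_return)
next
  case False
  then have "prob_space (uniform_measure M A)"
    by (intro prob_space_uniform_measure) (auto simp: measure_def)
  then show ?thesis
    using False assms
    by (auto simp: atom_distr_def intro!: prob_space.real_distribution_distr)
qed

lemma char_atom_distr:
  assumes X: "random_variable borel X" and A: "A \<in> events" "prob A \<noteq> 0"
  shows "char (atom_distr M X A) t = (\<integral>\<omega>. indicator A \<omega> *\<^sub>R iexp (t * X \<omega>) \<partial>M) /\<^sub>R prob A"
proof -
  have "char (atom_distr M X A) t = (\<integral>\<omega>. iexp (t * X \<omega>) \<partial>uniform_measure M A)"
    using A X by (simp add: atom_distr_def char_def integral_distr)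
  also have "\<dots> = (\<integral>\<omega>. indicator A \<omega> *\<^sub>R iexp (t * X \<omega>) \<partial>M) /\<^sub>R prob A"
    using A X by (intro integral_uniform_measure) (auto simp: emeasure_eq_measure)
  finally show ?thesis .
qed

text \<open>A \<open>\<sigma>\<close>-algebra generated by a countably valued map is atomic, so that conditioning on it is
  elementary conditioning on its atoms.\<close>

lemma regular_cond_distr_atoms:
  fixes p :: "'a \<Rightarrow> 'i::countable"
  assumes space_F: "space F = space M" and sets_F: "sets F = {p -` C \<inter> space M | C. True}"
    and p: "p \<in> measurable M (count_space UNIV)" and X: "random_variable borel X"
  shows "regular_cond_distr M F X (\<lambda>\<omega>. atom_distr M X (p -` {p \<omega>} \<inter> space M))"
proof -
  define \<kappa> where "\<kappa> w = atom_distr M X (p -` {w} \<inter> space M)" for w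
  have rd: "real_distribution (\<kappa> w)" for w
    unfolding \<kappa>_def by (rule real_distribution_atom_distr[OF X])
  have pF: "p \<in> measurable F (count_space UNIV)"
    using space_F sets_F by (auto simp: measurable_def)
  have sub: "subalgebra M F"
    using space_F sets_F p by (auto simp: subalgebra_def measurable_def)
  interpret fms: finite_measure_subalgebra M F
    by unfold_locales (rule sub)
  have \<kappa>_meas: "(\<lambda>\<omega>. \<kappa> (p \<omega>)) \<in> measurable F (prob_algebra borel)"
    using rd by (intro measurable_compose[OF pF])
      (auto simp: space_prob_algebra real_distribution_def real_distribution_axioms_def)
  have "AE \<omega> in M. real_cond_exp M F (indicator (X -` B \<inter> space M)) \<omega> = measure (\<kappa> (p \<omega>)) B"
    if B[measurable]: "B \<in> sets borel" for B
  proof (rule fms.real_cond_exp_charact)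
    let ?XB = "X -` B \<inter> space M"
    have XB[measurable]: "?XB \<in> events" using X by measurable
    note [measurable] = p
    have m1: "measure (\<kappa> w) B \<le> 1" for w
      using rd[of w] by (simp add: real_distribution_def prob_space.prob_le_1)
    show "integrable M (indicat_real ?XB)"
      by (simp add: emeasure_eq_measure)
    show "(\<lambda>\<omega>. measure (\<kappa> (p \<omega>)) B) \<in> borel_measurable F"
      by (rule measurable_compose[OF pF]) simp
    then show int: "integrable M (\<lambda>\<omega>. measure (\<kappa> (p \<omega>)) B)"
      using measurable_from_subalg[OF sub]
      by (intro integrable_const_bound[where B = 1]) (auto simp: m1)
    fix A assume "A \<in> sets F"
    then obtain C where A: "A = p -` C \<inter> space M" using sets_F by auto
    \<comment> \<open>Both sides of the averaging identity become measures on the countable index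
      type. They agree on singletons, that is on atoms, hence on every \<open>C\<close>, which
      covers all sets of \<open>F\<close>; on null atoms both sides are 0.\<close>
    define D where "D = distr (density M (indicator ?XB)) (count_space UNIV) p"
    define D' where "D' = density (distr M (count_space UNIV) p) (\<lambda>w. ennreal (measure (\<kappa> w) B))"
    have "D = D'"
    proof (rule measure_eqI_countable[where A = UNIV])
      fix w
      have pw: "p -` {w} \<inter> space M \<in> events" by measurable
      have "emeasure D {w} = emeasure M (?XB \<inter> (p -` {w} \<inter> space M))"
        unfolding D_def by (subst emeasure_distr) (auto simp: emeasure_density indicator_inter_arith[symmetric])
      also have "\<dots> = ennreal (measure (\<kappa> w) B) * emeasure M (p -` {w} \<inter> space M)"
      proof (cases "prob (p -` {w} \<inter> space M) = 0")
        case True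
        then have "prob (?XB \<inter> (p -` {w} \<inter> space M)) = 0"
          using finite_measure_mono[OF Int_lower2 pw, of ?XB] by (simp add: measure_le_0_iff)
        then show ?thesis using True by (simp add: emeasure_eq_measure)
      next
        case False
        then have "measure (\<kappa> w) B = prob ((p -` {w} \<inter> space M) \<inter> ?XB) / prob (p -` {w} \<inter> space M)"
          using X pw by (simp add: \<kappa>_def atom_distr_def measure_distr emeasure_eq_measure)
        then show ?thesis
          using False by (simp add: emeasure_eq_measure Int_commute flip: ennreal_mult)
      qed
      also have "\<dots> = emeasure D' {w}"
        unfolding D'_def by (simp add: emeasure_density emeasure_distr nn_integral_distr)
      finally show "emeasure D {w} = emeasure D' {w}" .
    qed (auto simp: D_def D'_def)
    then have "emeasure D C = emeasure D' C" by simp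
    also have "emeasure D C = emeasure M (?XB \<inter> A)"
      unfolding D_def A by (subst emeasure_distr) (auto simp: emeasure_density indicator_inter_arith[symmetric])
    also have "emeasure D' C = (\<integral>\<^sup>+\<omega>. ennreal (measure (\<kappa> (p \<omega>)) B * indicator A \<omega>) \<partial>M)"
      unfolding D'_def A
      by (subst emeasure_density) (auto simp: nn_integral_distr intro!: nn_integral_cong split: split_indicator)
    also have "\<dots> = ennreal (\<integral>\<omega>. measure (\<kappa> (p \<omega>)) B * indicator A \<omega> \<partial>M)"
    proof (rule nn_integral_eq_integral)
      have "A \<in> events" unfolding A by measurable
      from integrable_mult_indicator[OF this int]
      show "integrable M (\<lambda>\<omega>. measure (\<kappa> (p \<omega>)) B * indicator A \<omega>)" by (simp add: mult.commute)
    qed auto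
    finally have "prob (?XB \<inter> A) = (\<integral>\<omega>. measure (\<kappa> (p \<omega>)) B * indicator A \<omega> \<partial>M)"
      by (simp add: emeasure_eq_measure ennreal_inj integral_nonneg)
    moreover have "(\<integral>\<omega>. indicator A \<omega> * indicat_real ?XB \<omega> \<partial>M) = prob (?XB \<inter> A)"
      using A by (simp add: indicator_inter_arith[symmetric] Int_ac)
    ultimately show "set_lebesgue_integral M A (indicat_real ?XB) = (\<integral>\<omega>\<in>A. measure (\<kappa> (p \<omega>)) B \<partial>M)"
      by (simp add: set_lebesgue_integral_def mult.commute)
  qed
  then show ?thesis
    using \<kappa>_meas by (simp add: regular_cond_distr_def \<kappa>_def)
qed

end

section \<open>Histories as generators of the observation algebras\<close>

text \<open>Lists of naturals form a countable type, so the atoms of all observation algebras can be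
  indexed by it. \<open>Y 0\<close> is left out.\<close>

definition history :: "(nat \<Rightarrow> 'a \<Rightarrow> nat) \<Rightarrow> nat \<Rightarrow> 'a \<Rightarrow> nat list" where
  "history Y n \<omega> = map (\<lambda>i. Y i \<omega>) [1..<Suc n]"

lemma length_history [simp]: "length (history Y n \<omega>) = n"
  by (simp add: history_def)

lemma history_Suc: "history Y (Suc n) \<omega> = history Y n \<omega> @ [Y (Suc n) \<omega>]"
  by (simp add: history_def)

text \<open>Observations count from 1 and list positions from 0, hence the shift.\<close>

definition state :: "(nat \<Rightarrow> real) \<Rightarrow> real measure \<Rightarrow> nat list \<Rightarrow> real measure" where
  "state \<alpha> G0 w = learned \<alpha> G0 (\<lambda>i. w ! (i - 1)) (length w)"

lemma learned_cong: "(\<And>i. i \<in> {1..n} \<Longrightarrow> ys i = zs i) \<Longrightarrow> learned \<alpha> G0 ys n = learned \<alpha> G0 zs n"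
  by (induction n) auto

lemma state_history: "state \<alpha> G0 (history Y n \<omega>) = learned \<alpha> G0 (\<lambda>i. Y i \<omega>) n"
  unfolding state_def length_history
  by (rule learned_cong) (auto simp: history_def simp del: upt_Suc)

lemma state_Nil: "state \<alpha> G0 [] = G0"
  by (simp add: state_def)

lemma state_append: "state \<alpha> G0 (w @ [z]) = update (\<alpha> (Suc (length w))) (state \<alpha> G0 w) z"
proof -
  have "learned \<alpha> G0 (\<lambda>i. (w @ [z]) ! (i - 1)) (length w) = learned \<alpha> G0 (\<lambda>i. w ! (i - 1)) (length w)"
    by (rule learned_cong) (auto simp: nth_append)
  then show ?thesis
    by (simp add: state_def update_def)
qed

lemma measurable_history:
  assumes "\<And>i. 1 \<le> i \<Longrightarrow> i \<le> n \<Longrightarrow> Y i \<in> measurable N (count_space UNIV)"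
  shows "history Y n \<in> measurable N (count_space UNIV)"
  using assms
proof (induction n)
  case (Suc n)
  have "(\<lambda>\<omega>. history Y n \<omega> @ [Y (Suc n) \<omega>]) \<in> measurable N (count_space UNIV)"
  proof (rule measurable_compose_countable[where f = "\<lambda>u \<omega>. u @ [Y (Suc n) \<omega>]"])
    show "(\<lambda>\<omega>. u @ [Y (Suc n) \<omega>]) \<in> measurable N (count_space UNIV)" for u
      by (rule measurable_compose[OF Suc.prems[of "Suc n"]]) auto
    show "history Y n \<in> measurable N (count_space UNIV)" using Suc by simp
  qed
  then show ?case by (simp add: history_Suc[abs_def])
qed (simp add: history_def[abs_def])

lemma space_obs_algebra: "space (obs_algebra M Y n) = space M"
  unfolding obs_algebra_def by (intro space_measure_of) auto

text \<open>Each observation is a function of the list, and the list is measurable with respect to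
  the observations. This gives the shape of \<sigma>-algebra that
  \<open>regular_cond_distr_atoms\<close> expects.\<close>

lemma sets_obs_algebra: "sets (obs_algebra M Y n) = {history Y n -` C \<inter> space M | C. True}"
proof (rule antisym)
  let ?S = "{Y i -` A \<inter> space M | i A. i \<in> {1..n}}"
  have S: "sets (obs_algebra M Y n) = sigma_sets (space M) ?S"
    unfolding obs_algebra_def by (intro sets_measure_of) auto
  have V: "sets (vimage_algebra (space M) (history Y n) (count_space UNIV)) = {history Y n -` C \<inter> space M | C. True}"
    by (subst sets_vimage_algebra2) auto
  have "?S \<subseteq> sets (vimage_algebra (space M) (history Y n) (count_space UNIV))"
  proof
    fix s assume "s \<in> ?S"
    then obtain i A where i: "i \<in> {1..n}" "s = Y i -` A \<inter> space M" by auto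
    then have "s = history Y n -` {u. u ! (i - 1) \<in> A} \<inter> space M"
      by (auto simp: history_def simp del: upt_Suc)
    then show "s \<in> sets (vimage_algebra (space M) (history Y n) (count_space UNIV))"
      unfolding V by blast
  qed
  then show "sets (obs_algebra M Y n) \<subseteq> {history Y n -` C \<inter> space M | C. True}"
    unfolding S V[symmetric]
    using sets.sigma_sets_subset[of ?S "vimage_algebra (space M) (history Y n) (count_space UNIV)"] by simp
  have "Y i \<in> measurable (obs_algebra M Y n) (count_space UNIV)" if "1 \<le> i" "i \<le> n" for i
    using that unfolding measurable_def space_obs_algebra S by (auto intro!: sigma_sets.Basic)
  then have "history Y n \<in> measurable (obs_algebra M Y n) (count_space UNIV)"
    by (rule measurable_history)
  then show "{history Y n -` C \<inter> space M | C. True} \<subseteq> sets (obs_algebra M Y n)"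
    unfolding measurable_def space_obs_algebra by auto
qed

section \<open>The conditional law of the learned measures on an atom\<close>

locale bayes_learning = prob_space M + mixing_support \<Theta> r R
  for M :: "'a measure" and \<Theta> r R +
  fixes Y :: "nat \<Rightarrow> 'a \<Rightarrow> nat" and \<alpha> :: "nat \<Rightarrow> real" and G0 :: "real measure"
  assumes G0: "G0 \<in> mixing" and rate: "n \<ge> 1 \<Longrightarrow> 0 < \<alpha> n \<and> \<alpha> n < 1" and model: "learning_model M Y \<alpha> G0"
begin

abbreviation atom :: "nat \<Rightarrow> nat list \<Rightarrow> 'a set" where
  "atom n w \<equiv> history Y n -` {w} \<inter> space M"

abbreviation G :: "nat list \<Rightarrow> real measure" where
  "G \<equiv> state \<alpha> G0"

lemma history_measurable [measurable]: "history Y n \<in> measurable M (count_space UNIV)"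
  using model by (intro measurable_history) (auto simp: learning_model_def)

lemma atom_events [measurable]: "atom n w \<in> events"
  by measurable

lemma subalgebra_obs: "subalgebra M (obs_algebra M Y n)"
  using history_measurable[of n] by (auto simp: subalgebra_def space_obs_algebra sets_obs_algebra measurable_def)

lemma state_mixing: "G w \<in> mixing"
proof (induction w rule: rev_induct)
  case (snoc z w)
  then show ?case
    using rate[of "Suc (length w)"] by (simp add: state_append update_mixing)
qed (simp add: state_Nil G0)

text \<open>The conditional probability of the next observation is integrated over an atom, where
  the learned measure is the constant \<open>G w\<close>. This is the only place where the
  prediction rule of the model is integrated.\<close>

lemma prob_atom_append: "prob (atom (Suc n) (w @ [z])) = prob (atom n w) * marginal (G w) z"
proof -
  let ?Z = "Y (Suc n) -` {z} \<inter> space M" and ?F = "obs_algebra M Y n"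
  interpret fms: finite_measure_subalgebra M ?F
    by unfold_locales (rule subalgebra_obs)
  have [measurable]: "Y (Suc n) \<in> measurable M (count_space UNIV)"
    using model by (simp add: learning_model_def)
  have Z: "?Z \<in> events" by measurable
  have A: "atom n w \<in> sets ?F" by (auto simp: sets_obs_algebra)
  have AE: "AE \<omega> in M. real_cond_exp M ?F (indicator ?Z) \<omega> = marginal (learned \<alpha> G0 (\<lambda>i. Y i \<omega>) n) z"
    using model by (simp add: learning_model_def)
  have "prob (atom (Suc n) (w @ [z])) = (\<integral>\<omega>. indicator (atom n w) \<omega> * indicat_real ?Z \<omega> \<partial>M)"
  proof -
    have "atom (Suc n) (w @ [z]) = atom n w \<inter> ?Z" by (auto simp: history_Suc)
    then show ?thesis by (simp add: indicator_inter_arith[symmetric])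
  qed
  also have "\<dots> = (\<integral>\<omega>. indicator (atom n w) \<omega> * real_cond_exp M ?F (indicator ?Z) \<omega> \<partial>M)"
    using fms.real_cond_exp_intA[OF _ A, of "indicat_real ?Z"] Z
    by (simp add: set_lebesgue_integral_def emeasure_eq_measure)
  also have "\<dots> = (\<integral>\<omega>. indicator (atom n w) \<omega> * marginal (G w) z \<partial>M)"
  proof (rule integral_cong_AE)
    show "AE \<omega> in M. indicator (atom n w) \<omega> * real_cond_exp M ?F (indicator ?Z) \<omega>
        = indicator (atom n w) \<omega> * marginal (G w) z"
      using AE by eventually_elim (auto simp: state_history[symmetric] split: split_indicator)
  qed (use atom_events in auto)
  finally show ?thesis by simp
qed

text \<open>Transfers expectations from the probability space to the chain. The atom is split
  according to the next observation, each piece has the weight of one chain step, and the induction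
  hypothesis applies to the longer history. Measurability holds for arbitrary \<open>h\<close>
  because the history is countably valued.\<close>

lemma expectation_atom_eq_chain:
  fixes h :: "real measure \<Rightarrow> complex"
  assumes h: "\<And>H. norm (h H) \<le> B"
  shows "length w = n \<Longrightarrow>
    (\<integral>\<omega>. indicator (atom n w) \<omega> *\<^sub>R h (G (history Y (n + m) \<omega>)) \<partial>M)
      = prob (atom n w) *\<^sub>R measure_pmf.expectation (chain m (\<lambda>j. \<alpha> (Suc (n + j))) (G w)) h"
proof (induction m arbitrary: n w)
  case 0
  have "(\<integral>\<omega>. indicator (atom n w) \<omega> *\<^sub>R h (G (history Y (n + 0) \<omega>)) \<partial>M)
      = (\<integral>\<omega>. indicator (atom n w) \<omega> *\<^sub>R h (G w) \<partial>M)"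
    by (intro Bochner_Integration.integral_cong) (auto split: split_indicator)
  then show ?case by (simp add: emeasure_eq_measure)
next
  case (Suc m)
  let ?h = "\<lambda>\<omega>. h (G (history Y (n + Suc m) \<omega>))"
  let ?C = "\<lambda>z. measure_pmf.expectation (chain m (\<lambda>j. \<alpha> (Suc (n + Suc j))) (update (\<alpha> (Suc n)) (G w) z)) h"
  let ?f = "\<lambda>z \<omega>. indicator (atom (Suc n) (w @ [z])) \<omega> *\<^sub>R ?h \<omega>"
  have B: "0 \<le> B" using h[of undefined] norm_ge_zero order_trans by blast
  have meas: "(\<lambda>\<omega>. h (G (history Y k \<omega>))) \<in> borel_measurable M" for k
    by (rule measurable_compose[OF history_measurable]) simp
  have int: "integrable M (?f z)" for z
    using meas h by (intro integrable_const_bound[where B = B])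
      (auto simp: B split: split_indicator intro!: borel_measurable_scaleR borel_measurable_indicator)
  have step: "integral\<^sup>L M (?f z) = prob (atom n w) *\<^sub>R (pmf (predictive (G w)) z *\<^sub>R ?C z)" for z
    using Suc.IH[of "w @ [z]" "Suc n"] Suc.prems
    by (simp add: state_append prob_atom_append pmf_predictive[OF state_mixing])
  \<comment> \<open>Only the piece with z equal to the actual next observation contains \<omega>, so
    the series has at most one nonzero term.\<close>
  have pt: "(\<lambda>z. ?f z \<omega>) sums (indicator (atom n w) \<omega> *\<^sub>R ?h \<omega>)" for \<omega>
  proof -
    have "?f z \<omega> = (if z = Y (Suc n) \<omega> then indicator (atom n w) \<omega> *\<^sub>R ?h \<omega> else 0)" for z
      by (auto simp: history_Suc split: split_indicator)
    then show ?thesis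
      using sums_single[of "Y (Suc n) \<omega>" "\<lambda>_. indicator (atom n w) \<omega> *\<^sub>R ?h \<omega>"] by simp
  qed
  have "(\<lambda>z. integral\<^sup>L M (?f z)) sums (\<integral>\<omega>. (\<Sum>z. ?f z \<omega>) \<partial>M)"
  proof (rule sums_integral[OF int])
    have "norm (?f z \<omega>) = (if z = Y (Suc n) \<omega> then norm (indicator (atom n w) \<omega> *\<^sub>R ?h \<omega>) else 0)" for z \<omega>
      by (auto simp: history_Suc split: split_indicator)
    then show "AE \<omega> in M. summable (\<lambda>z. norm (?f z \<omega>))"
      using sums_summable[OF sums_single[of _ "\<lambda>_. norm (indicator (atom n w) _ *\<^sub>R ?h _)"]] by simp
    show "summable (\<lambda>z. \<integral>\<omega>. norm (?f z \<omega>) \<partial>M)"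
    proof (rule summable_comparison_test')
      show "summable (\<lambda>z. prob (atom n w) * marginal (G w) z * B)"
        by (intro summable_mult2 summable_mult sums_summable[OF marginal_sums[OF state_mixing]])
      fix z :: nat
      have "(\<integral>\<omega>. norm (?f z \<omega>) \<partial>M) \<le> (\<integral>\<omega>. indicator (atom (Suc n) (w @ [z])) \<omega> * B \<partial>M)"
        using h by (intro integral_mono integrable_norm[OF int])
          (auto simp: emeasure_eq_measure split: split_indicator)
      also have "\<dots> = prob (atom n w) * marginal (G w) z * B"
        by (simp add: prob_atom_append)
      finally show "norm (\<integral>\<omega>. norm (?f z \<omega>) \<partial>M) \<le> prob (atom n w) * marginal (G w) z * B"
        by (simp add: Bochner_Integration.integral_nonneg)
    qed
  qed
  moreover have "(\<lambda>z. integral\<^sup>L M (?f z)) sums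
      (prob (atom n w) *\<^sub>R measure_pmf.expectation (predictive (G w)) ?C)"
    unfolding step
    by (intro sums_scaleR_right sums_expectation_pmf_nat integrable_measure_pmf_bounded[where B = B]
        norm_expectation_pmf_le h)
  ultimately have "(\<integral>\<omega>. (\<Sum>z. ?f z \<omega>) \<partial>M)
      = prob (atom n w) *\<^sub>R measure_pmf.expectation (predictive (G w)) ?C"
    by (rule sums_unique2)
  moreover have "(\<Sum>z. ?f z \<omega>) = indicator (atom n w) \<omega> *\<^sub>R ?h \<omega>" for \<omega>
    using pt by (rule sums_unique[symmetric])
  moreover have "measure_pmf.expectation (chain (Suc m) (\<lambda>j. \<alpha> (Suc (n + j))) (G w)) h
      = measure_pmf.expectation (predictive (G w)) ?C"
    using rate h by (subst chain_cexpectation_step[where B = B]) (auto simp: state_mixing less_imp_le)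
  ultimately show ?case by simp
qed

end

section \<open>Almost sure convergence of the conditional distributions\<close>

context mixing_support
begin

section \<open>Continuity and measurability of the functionals\<close>

lemma continuous_on_likelihood: "continuous_on \<Theta> (likelihood z)"
proof -
  have "continuous_on \<Theta> (\<lambda>\<theta>. \<theta> ^ z / fact z * exp (- \<theta>))"
    by (intro continuous_intros) auto
  then show ?thesis
    by (rule continuous_on_cong[THEN iffD1, rotated 2]) (auto simp: likelihood_eq)
qed

text \<open>A quotient of integrals of continuous functions against \<open>G\<close> itself; weak
  convergence and measurability of \<open>G\<close> therefore carry over to the posterior.\<close>

lemma marginal_posterior:
  "G \<in> mixing \<Longrightarrow> marginal (posterior G z) y = (\<integral>\<theta>. likelihood z \<theta> * likelihood y \<theta> \<partial>G) / marginal G z"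
  using likelihood_bounded_on(1)[of y] by (simp add: marginal_def[of "posterior G z"] integral_posterior)

context
  fixes Gs :: "nat \<Rightarrow> real measure" and H :: "real measure"
  assumes Gs: "\<And>n. Gs n \<in> mixing" and H: "H \<in> mixing" and weak: "weak_conv_on \<Theta> Gs H"
begin

lemma weak_conv_integral_tendsto:
  assumes "continuous_on \<Theta> f" "bounded_on f B"
  shows "(\<lambda>n. \<integral>\<theta>. f \<theta> \<partial>Gs n) \<longlonglongrightarrow> (\<integral>\<theta>. f \<theta> \<partial>H)"
proof -
  have "bounded (f ` \<Theta>)"
    using assms(2) by (auto simp: bounded_iff)
  then show ?thesis
    using weak assms(1) by (simp add: weak_conv_on_def)
qed

lemma marginal_tendsto: "(\<lambda>n. marginal (Gs n) z) \<longlonglongrightarrow> marginal H z"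
  unfolding marginal_def by (rule weak_conv_integral_tendsto[OF continuous_on_likelihood likelihood_bounded_on(1)])

lemma marginal_posterior_tendsto:
  "(\<lambda>n. marginal (posterior (Gs n) z) y) \<longlonglongrightarrow> marginal (posterior H z) y"
  unfolding marginal_posterior[OF Gs] marginal_posterior[OF H] using marginal_pos[OF H, of z]
  by (intro tendsto_divide marginal_tendsto weak_conv_integral_tendsto[where B = "1 * 1"] bounded_on_mult
      likelihood_bounded_on continuous_on_mult continuous_on_likelihood) auto

lemma bayes_est_tendsto: "(\<lambda>n. bayes_est (Gs n) y) \<longlonglongrightarrow> bayes_est H y"
  unfolding bayes_est_def using marginal_pos[OF H, of y]
  by (intro tendsto_intros marginal_tendsto) auto

text \<open>Weak convergence gives the limit of each term of the series. Tannery's theorem applies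
  with the summable majorant \<open>lik_ub z * ?C^2\<close>: the marginals in the denominators are
  taken only at y and y + 1, so one constant bounds the brackets for all z.\<close>

lemma limit_variance_tendsto: "(\<lambda>n. limit_variance (Gs n) y) \<longlonglongrightarrow> limit_variance H y"
proof -
  let ?C = "1 / lik_lb y + 1 / lik_lb (y + 1)"
  let ?d = "\<lambda>G z. marginal (posterior G z) y / marginal G y
      - marginal (posterior G z) (y + 1) / marginal G (y + 1)"
  have ratio: "\<bar>marginal (posterior G z) x / marginal G x\<bar> \<le> 1 / lik_lb x" if "G \<in> mixing" for G x z
    using marginal_posterior_le[OF that, of z x] marginal_ge[OF that, of x] lik_lb_pos[of x]
      marginal_pos[OF posterior_mixing[OF that], of z x]
    by (simp add: frac_le)
  have d: "(?d G z)\<^sup>2 \<le> ?C\<^sup>2" if "G \<in> mixing" for G z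
  proof -
    have "\<bar>?d G z\<bar> \<le> ?C"
      using ratio[OF that, of z y] ratio[OF that, of z "y + 1"] by linarith
    then show ?thesis using power_mono[of "\<bar>?d G z\<bar>" ?C 2] by simp
  qed
  have "(\<lambda>n. \<Sum>z. marginal (Gs n) z * (?d (Gs n) z)\<^sup>2) \<longlonglongrightarrow> (\<Sum>z. marginal H z * (?d H z)\<^sup>2)"
  proof (rule tannerys_theorem[THEN conjunct2, THEN conjunct2])
    show "(\<lambda>n. marginal (Gs n) z * (?d (Gs n) z)\<^sup>2) \<longlonglongrightarrow> marginal H z * (?d H z)\<^sup>2" for z
      using marginal_pos[OF H]
      by (intro tendsto_intros marginal_tendsto marginal_posterior_tendsto) (auto simp: less_imp_neq[symmetric])
    have "norm (marginal (Gs n) z * (?d (Gs n) z)\<^sup>2) \<le> lik_ub z * ?C\<^sup>2" for z n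
      using mult_mono[OF marginal_le[OF Gs] d[OF Gs, of n z]] lik_ub_nonneg[of z] marginal_pos[OF Gs, of n z]
      by (simp add: abs_mult)
    then show "\<forall>\<^sub>F (z, n) in at_top \<times>\<^sub>F sequentially.
        norm (marginal (Gs n) z * (?d (Gs n) z)\<^sup>2) \<le> lik_ub z * ?C\<^sup>2"
      by (intro always_eventually) auto
    show "summable (\<lambda>z. lik_ub z * ?C\<^sup>2)"
      by (intro summable_mult2 sums_summable[OF lik_ub_sums])
  qed simp
  then show ?thesis
    unfolding limit_variance_def by (intro tendsto_mult tendsto_power bayes_est_tendsto)
qed

end

text \<open>Both functionals are built from countably many integrals of fixed functions, and these
  depend measurably on the measure.\<close>

lemma
  assumes [measurable]: "L \<in> measurable M (prob_algebra (restrict_space borel \<Theta>))"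
  shows measurable_bayes_est: "(\<lambda>\<omega>. bayes_est (L \<omega>) y) \<in> borel_measurable M"
    and measurable_limit_variance: "(\<lambda>\<omega>. limit_variance (L \<omega>) y) \<in> borel_measurable M"
proof -
  have int: "(\<lambda>\<omega>. \<integral>\<theta>. f \<theta> \<partial>L \<omega>) \<in> borel_measurable M"
    if "f \<in> borel_measurable (restrict_space borel \<Theta>)" for f :: "real \<Rightarrow> real"
    using measurable_compose[OF measurable_prob_algebraD[OF assms] integral_measurable_subprob_algebra[OF that]] .
  have marg[measurable]: "(\<lambda>\<omega>. marginal (L \<omega>) z) \<in> borel_measurable M" for z
    unfolding marginal_def using likelihood_bounded_on(1)[of z] by (intro int) auto
  have [measurable]: "(\<lambda>\<omega>. \<integral>\<theta>. likelihood z \<theta> * likelihood x \<theta> \<partial>L \<omega>) \<in> borel_measurable M" for z x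
    using bounded_on_mult[OF likelihood_bounded_on(1)[of z] likelihood_bounded_on(1)[of x]] by (intro int) auto
  show bayes[measurable]: "(\<lambda>\<omega>. bayes_est (L \<omega>) y) \<in> borel_measurable M"
    unfolding bayes_est_def by measurable
  have [measurable]: "(\<lambda>\<omega>. marginal (posterior (L \<omega>) z) x) \<in> borel_measurable M" for z x
  proof -
    have "(\<lambda>\<omega>. (\<integral>\<theta>. likelihood z \<theta> * likelihood x \<theta> \<partial>L \<omega>) / marginal (L \<omega>) z) \<in> borel_measurable M"
      by measurable
    then show ?thesis
      by (rule measurable_cong[THEN iffD1, rotated])
         (use measurable_space[OF assms] in \<open>simp add: marginal_posterior\<close>)
  qed
  show "(\<lambda>\<omega>. limit_variance (L \<omega>) y) \<in> borel_measurable M"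
    unfolding limit_variance_def by measurable
qed

lemma limit_variance_nonneg: "G \<in> mixing \<Longrightarrow> 0 \<le> limit_variance G y"
  unfolding limit_variance_eq_innovation_var
  by (rule innovation_var_nonneg[OF _ est_gradient_bounded_on])

text \<open>With \<open>s = t \<surd>b\<close> every term of the error splits into a power of \<open>b S \<rightarrow> 1\<close> times one of
  \<open>S \<rightarrow> 0\<close> and \<open>c\<^sup>2 b \<rightarrow> 0\<close>.\<close>

lemma clt_error_tendsto_0:
  fixes c S b :: "nat \<Rightarrow> real"
  assumes nn: "\<forall>\<^sub>F n in sequentially. 0 \<le> c n \<and> 0 \<le> S n \<and> 0 \<le> b n"
    and S: "S \<longlonglongrightarrow> 0" and bS: "(\<lambda>n. b n * S n) \<longlonglongrightarrow> 1" and cb: "(\<lambda>n. (c n)\<^sup>2 * b n) \<longlonglongrightarrow> 0"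
  shows "(\<lambda>n. clt_error y (c n) (S n) (t * sqrt (b n))) \<longlonglongrightarrow> 0"
proof -
  let ?B = "est_gradient_bound y"
  let ?e = "\<lambda>n. 2 * est_remainder_const y * \<bar>t\<bar> * (sqrt (b n * S n) * sqrt (S n))
     + (4 / 3 * ?B ^ 3 * \<bar>t\<bar> ^ 3 * ((b n * S n) * sqrt ((c n)\<^sup>2 * b n))
        + (3 * exp R + 2) * ?B\<^sup>2 / 2 * t\<^sup>2 * ((b n * S n) * sqrt (S n))
        + ?B ^ 4 / 8 * t ^ 4 * ((b n * S n) * ((c n)\<^sup>2 * b n)))"
  have "?e \<longlonglongrightarrow> 2 * est_remainder_const y * \<bar>t\<bar> * (sqrt 1 * sqrt 0)
     + (4 / 3 * ?B ^ 3 * \<bar>t\<bar> ^ 3 * (1 * sqrt 0)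
        + (3 * exp R + 2) * ?B\<^sup>2 / 2 * t\<^sup>2 * (1 * sqrt 0)
        + ?B ^ 4 / 8 * t ^ 4 * (1 * 0))"
    by (intro tendsto_intros S bS cb)
  moreover have "\<forall>\<^sub>F n in sequentially. ?e n = clt_error y (c n) (S n) (t * sqrt (b n))"
    using nn
  proof eventually_elim
    case (elim n)
    \<comment> \<open>Writing \<open>b\<close> and \<open>S\<close> as squares of nonnegative
      numbers removes the roots, and the claimed equality becomes polynomial.\<close>
    obtain x where x: "0 \<le> x" "b n = x\<^sup>2" using elim by (metis real_sqrt_ge_zero real_sqrt_pow2)
    obtain u where u: "0 \<le> u" "S n = u\<^sup>2" using elim by (metis real_sqrt_ge_zero real_sqrt_pow2)
    show ?case
      unfolding clt_error_def x u using x(1) u(1) elim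
      by (simp add: real_sqrt_mult abs_mult power_mult_distrib eval_nat_numeral algebra_simps)
  qed
  ultimately show ?thesis
    by (auto intro: Lim_transform_eventually)
qed

end

section \<open>Passage to the limit on atoms\<close>

context bayes_learning
begin

text \<open>The chain bound holds for every m, so both sides pass to the limit: G_(n+m) is replaced
  by its weak limit through dominated convergence, the partial sums by \<open>S\<close>.
  Monotonicity makes the first remaining rate the bound \<open>c\<close> for all later ones.\<close>

lemma expectation_atom_approx:
  assumes L: "L \<in> measurable M (prob_algebra (restrict_space borel \<Theta>))"
    and weak: "AE \<omega> in M. weak_conv_on \<Theta> (\<lambda>n. learned \<alpha> G0 (\<lambda>i. Y i \<omega>) n) (L \<omega>)"
    and anti: "\<And>i j. 1 \<le> i \<Longrightarrow> i \<le> j \<Longrightarrow> \<alpha> j \<le> \<alpha> i"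
    and S: "(\<lambda>j. (\<alpha> (Suc (n + j)))\<^sup>2) sums S" and w: "length w = n" "prob (atom n w) \<noteq> 0"
  shows "cmod ((\<integral>\<omega>. indicator (atom n w) \<omega> *\<^sub>R iexp (s * (bayes_est (L \<omega>) y - bayes_est (G w) y)) \<partial>M)
        /\<^sub>R prob (atom n w) - exp (- (s\<^sup>2 * S * limit_variance (G w) y / 2)))
    \<le> clt_error y (\<alpha> (Suc n)) S s"
proof -
  let ?a = "\<lambda>j. \<alpha> (Suc (n + j))" and ?S = "\<lambda>m. \<Sum>j<m. (\<alpha> (Suc (n + j)))\<^sup>2"
  let ?h = "\<lambda>H. iexp (s * (bayes_est H y - bayes_est (G w) y))"
  let ?I = "\<lambda>H. \<integral>\<omega>. indicator (atom n w) \<omega> *\<^sub>R ?h (H \<omega>) \<partial>M"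
  let ?E = "\<lambda>m. measure_pmf.expectation (chain m ?a (G w)) ?h"
  have SS: "?S \<longlonglongrightarrow> S" using S by (simp add: sums_def)
  have "(\<lambda>m. ?I (\<lambda>\<omega>. G (history Y (n + m) \<omega>))) \<longlonglongrightarrow> ?I L"
  proof (rule integral_dominated_convergence[where w = "\<lambda>_. 1"])
    note measurable_bayes_est[OF L, of y, measurable]
    show "(\<lambda>\<omega>. indicator (atom n w) \<omega> *\<^sub>R ?h (L \<omega>)) \<in> borel_measurable M" by measurable
    show "(\<lambda>\<omega>. indicator (atom n w) \<omega> *\<^sub>R ?h (G (history Y (n + m) \<omega>))) \<in> borel_measurable M" for m
    proof -
      have [measurable]: "(\<lambda>\<omega>. ?h (G (history Y (n + m) \<omega>))) \<in> borel_measurable M"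
        by (rule measurable_compose[OF history_measurable]) simp
      show ?thesis by measurable
    qed
    show "AE \<omega> in M. (\<lambda>m. indicator (atom n w) \<omega> *\<^sub>R ?h (G (history Y (n + m) \<omega>)))
        \<longlonglongrightarrow> indicator (atom n w) \<omega> *\<^sub>R ?h (L \<omega>)"
      using weak
    proof (rule AE_mp, intro AE_I2 impI)
      fix \<omega> assume \<omega>: "\<omega> \<in> space M" "weak_conv_on \<Theta> (\<lambda>n. learned \<alpha> G0 (\<lambda>i. Y i \<omega>) n) (L \<omega>)"
      have "(\<lambda>n. bayes_est (G (history Y n \<omega>)) y) \<longlonglongrightarrow> bayes_est (L \<omega>) y"
        using \<omega> measurable_space[OF L \<omega>(1)] by (intro bayes_est_tendsto state_mixing) (auto simp: state_history)
      from LIMSEQ_ignore_initial_segment[OF this, of n]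
      have "(\<lambda>m. bayes_est (G (history Y (n + m) \<omega>)) y) \<longlonglongrightarrow> bayes_est (L \<omega>) y"
        by (simp add: add.commute)
      then show "(\<lambda>m. indicator (atom n w) \<omega> *\<^sub>R ?h (G (history Y (n + m) \<omega>)))
        \<longlonglongrightarrow> indicator (atom n w) \<omega> *\<^sub>R ?h (L \<omega>)"
        by (intro tendsto_intros)
    qed
    show "AE \<omega> in M. norm (indicator (atom n w) \<omega> *\<^sub>R ?h (G (history Y (n + m) \<omega>))) \<le> 1" for m
      by (auto split: split_indicator)
  qed simp
  moreover have "?I (\<lambda>\<omega>. G (history Y (n + m) \<omega>)) = prob (atom n w) *\<^sub>R ?E m" for m
    by (rule expectation_atom_eq_chain[where B = 1]) (simp_all add: w)
  ultimately have "(\<lambda>m. (prob (atom n w) *\<^sub>R ?E m) /\<^sub>R prob (atom n w)) \<longlonglongrightarrow> ?I L /\<^sub>R prob (atom n w)"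
    by (intro tendsto_intros) simp
  then have E: "?E \<longlonglongrightarrow> ?I L /\<^sub>R prob (atom n w)"
    using w(2) by simp
  have "(\<lambda>m. cmod (?E m - exp (- (s\<^sup>2 * ?S m * limit_variance (G w) y / 2))))
      \<longlonglongrightarrow> cmod (?I L /\<^sub>R prob (atom n w) - exp (- (s\<^sup>2 * S * limit_variance (G w) y / 2)))"
    by (intro tendsto_intros E SS) simp
  moreover have "(\<lambda>m. clt_error y (\<alpha> (Suc n)) (?S m) s) \<longlonglongrightarrow> clt_error y (\<alpha> (Suc n)) S s"
    unfolding clt_error_def by (intro tendsto_intros SS)
  moreover have "cmod (?E m - exp (- (s\<^sup>2 * ?S m * limit_variance (G w) y / 2)))
      \<le> clt_error y (\<alpha> (Suc n)) (?S m) s" for m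
    using rate anti by (intro chain_bayes_est_clt state_mixing) (auto simp: less_imp_le)
  ultimately show ?thesis
    by (intro LIMSEQ_le) auto
qed

text \<open>The null atoms of all lengths are countably many. Off their union the default value in
  \<open>atom_distr\<close> is never met.\<close>

lemma AE_history_atom_pos: "AE \<omega> in M. \<forall>n. prob (atom n (history Y n \<omega>)) \<noteq> 0"
proof -
  have "AE \<omega> in M. history Y n \<omega> = w \<longrightarrow> prob (atom n w) \<noteq> 0" for n w
  proof (cases "prob (atom n w) = 0")
    case True
    then have "AE \<omega> in M. \<omega> \<notin> atom n w"
      by (subst prob_eq_0[symmetric]) auto
    then have "AE \<omega> in M. history Y n \<omega> \<noteq> w" by auto
    then show ?thesis by eventually_elim simp
  qed simp
  then have "AE \<omega> in M. \<forall>n w. history Y n \<omega> = w \<longrightarrow> prob (atom n w) \<noteq> 0"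
    by (intro AE_all_countable[THEN iffD2] allI)
  then show ?thesis by eventually_elim auto
qed

end

theorem theorem2p2:
  fixes M :: "'a measure" and Y :: "nat \<Rightarrow> 'a \<Rightarrow> nat"
    and \<Theta> :: "real set" and G0 :: "real measure" and \<alpha> :: "nat \<Rightarrow> real"
    and Glim :: "'a \<Rightarrow> real measure" and y :: nat
  assumes "prob_space M"
    and "compact \<Theta>" and "\<Theta> \<subseteq> {0<..}"
    and "prob_space G0" and "sets G0 = sets (restrict_space borel \<Theta>)"
    and "\<And>n. n \<ge> 1 \<Longrightarrow> 0 < \<alpha> n \<and> \<alpha> n < 1"
    and "\<And>m n. 1 \<le> m \<Longrightarrow> m \<le> n \<Longrightarrow> \<alpha> n \<le> \<alpha> m"
    and "\<not> summable (\<lambda>n. \<alpha> (Suc n))"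
    and "summable (\<lambda>n. (\<alpha> (Suc n))\<^sup>2)"
    and "summable (\<lambda>n. ((\<alpha> (Suc n))\<^sup>2 / (\<Sum>k. (\<alpha> (Suc n + k))\<^sup>2))\<^sup>2)"
    and "learning_model M Y \<alpha> G0"
    and "Glim \<in> measurable M (prob_algebra (restrict_space borel \<Theta>))"
    and "AE \<omega> in M. weak_conv_on \<Theta> (\<lambda>n. learned \<alpha> G0 (\<lambda>i. Y i \<omega>) n) (Glim \<omega>)"
  shows "cond_distr_conv_gaussian M (obs_algebra M Y)
           (\<lambda>n \<omega>. sqrt (tail_rate \<alpha> n)
                    * (bayes_est (Glim \<omega>) y - bayes_est (learned \<alpha> G0 (\<lambda>i. Y i \<omega>) n) y))
           (\<lambda>\<omega>. limit_variance (Glim \<omega>) y)"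
proof -
  note rate = assms(6) and anti = assms(7) and Glim = assms(12) and weak = assms(13)
  have "\<Theta> \<noteq> {}"
    using prob_space.not_empty[OF assms(4)] sets_eq_imp_space_eq[OF assms(5)] by (simp add: space_restrict_space)
  \<comment> \<open>The extreme points of \<Theta> serve as the interval bounds; the minimum is
    positive because it belongs to \<Theta>.\<close>
  obtain r where r: "r \<in> \<Theta>" "\<And>\<theta>. \<theta> \<in> \<Theta> \<Longrightarrow> r \<le> \<theta>"
    using compact_attains_inf[OF assms(2) \<open>\<Theta> \<noteq> {}\<close>] by blast
  obtain R where R: "R \<in> \<Theta>" "\<And>\<theta>. \<theta> \<in> \<Theta> \<Longrightarrow> \<theta> \<le> R"
    using compact_attains_sup[OF assms(2) \<open>\<Theta> \<noteq> {}\<close>] by blast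
  interpret prob_space M by (rule assms(1))
  interpret bayes_learning M \<Theta> r R Y \<alpha> G0
  proof unfold_locales
    show "\<Theta> \<in> sets borel" using assms(2) by (intro borel_closed compact_imp_closed)
    show "0 < r" using r(1) assms(3) by auto
    show "G0 \<in> space (prob_algebra (restrict_space borel \<Theta>))"
      using assms(4,5) by (simp add: space_prob_algebra)
  qed (use r R assms(6,11) in auto)
  define T where "T n = (\<Sum>k. (\<alpha> (n + k))\<^sup>2)" for n
  have sq: "summable (\<lambda>k. (\<alpha> (n + k))\<^sup>2)" if "1 \<le> n" for n
    using summable_ignore_initial_segment[OF assms(9), of "n - 1"] that by (simp add: add.commute)
  have T_pos: "0 < T n" if "1 \<le> n" for n
    unfolding T_def
    by (intro suminf_pos sq zero_less_power rate[THEN conjunct1]) (use that in auto)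
  have T_Suc: "T (Suc n) = T n - (\<alpha> n)\<^sup>2" if "1 \<le> n" for n
    using suminf_split_head[OF sq[OF that]] by (simp add: T_def)
  have T_0: "(\<lambda>n. T (Suc n)) \<longlonglongrightarrow> 0"
  proof -
    have "(\<lambda>n. suminf (\<lambda>k. (\<alpha> (Suc (k + n)))\<^sup>2)) \<longlonglongrightarrow> 0"
      by (rule suminf_exist_split2[OF assms(9)])
    then show ?thesis by (simp add: T_def add.commute)
  qed
  \<comment> \<open>The terms of the third summable series tend to 0, and this ratio is the square
    root of those terms, up to an index shift.\<close>
  have ratio: "(\<lambda>n. (\<alpha> n)\<^sup>2 / T n) \<longlonglongrightarrow> 0"
  proof -
    have "(\<lambda>n. ((\<alpha> (Suc n))\<^sup>2 / T (Suc n))\<^sup>2) \<longlonglongrightarrow> 0"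
      using summable_LIMSEQ_zero[OF assms(10)] by (simp add: T_def)
    from tendsto_real_sqrt[OF this] show ?thesis
      by (subst filterlim_sequentially_Suc[symmetric]) (simp add: real_sqrt_abs tendsto_rabs_zero_iff del: abs_divide)
  qed
  have tail: "tail_rate \<alpha> n = 1 / T n" for n
    by (simp add: tail_rate_def T_def divide_inverse)
  define Z where "Z n \<omega> = sqrt (tail_rate \<alpha> n) * (bayes_est (Glim \<omega>) y - bayes_est (G (history Y n \<omega>)) y)" for n \<omega>
  have Z_meas: "Z n \<in> borel_measurable M" for n
  proof -
    have [measurable]: "(\<lambda>\<omega>. bayes_est (G (history Y n \<omega>)) y) \<in> borel_measurable M"
      by (rule measurable_compose[OF history_measurable]) simp
    note measurable_bayes_est[OF Glim, of y, measurable]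
    show ?thesis unfolding Z_def[abs_def] by measurable
  qed
  \<comment> \<open>At n = 0 the scaling would involve \<open>\<alpha> 0\<close>; the estimates
    below that involve the rates start at n = 1.\<close>
  define K where "K n \<omega> = atom_distr M (Z n) (atom n (history Y n \<omega>))" for n \<omega>
  have K: "regular_cond_distr M (obs_algebra M Y n) (Z n) (K n)" for n
    unfolding K_def[abs_def]
    by (rule regular_cond_distr_atoms[OF space_obs_algebra sets_obs_algebra history_measurable Z_meas])
  have "AE \<omega> in M. weak_conv_m (\<lambda>n. K n \<omega>) (centered_gaussian (limit_variance (Glim \<omega>) y))"
    using weak AE_history_atom_pos
  proof (rule AE_mp[OF AE_conjI], intro AE_I2 impI)
    fix \<omega> assume \<omega>: "\<omega> \<in> space M" and *: "weak_conv_on \<Theta> (\<lambda>n. learned \<alpha> G0 (\<lambda>i. Y i \<omega>) n) (Glim \<omega>)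
      \<and> (\<forall>n. prob (atom n (history Y n \<omega>)) \<noteq> 0)"
    have Gl: "Glim \<omega> \<in> mixing" by (rule measurable_space[OF Glim \<omega>])
    let ?V = "\<lambda>n. limit_variance (G (history Y n \<omega>)) y" and ?W = "limit_variance (Glim \<omega>) y"
    have V: "?V \<longlonglongrightarrow> ?W"
      using * Gl by (intro limit_variance_tendsto state_mixing) (auto simp: state_history)
    show "weak_conv_m (\<lambda>n. K n \<omega>) (centered_gaussian ?W)"
    proof (rule levy_continuity)
      show "real_distribution (K n \<omega>)" for n
        unfolding K_def by (rule real_distribution_atom_distr[OF Z_meas])
      show "real_distribution (centered_gaussian ?W)"
        by (rule real_distribution_centered_gaussian[OF limit_variance_nonneg[OF Gl]])
      fix t
      let ?s = "\<lambda>n. t * sqrt (1 / T n)"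
      \<comment> \<open>\<open>T (Suc n)\<close> is the squared rate still to come after time n,
        while the scaling in \<open>?s n\<close> is by \<open>T n\<close>. The mismatch is settled
        by \<open>bS\<close>.\<close>
      have bound: "cmod (char (K n \<omega>) t - exp (- ((?s n)\<^sup>2 * T (Suc n) * ?V n / 2)))
          \<le> clt_error y (\<alpha> (Suc n)) (T (Suc n)) (?s n)" if n: "1 \<le> n" for n
      proof -
        let ?w = "history Y n \<omega>"
        have "char (K n \<omega>) t
          = (\<integral>\<omega>'. indicator (atom n ?w) \<omega>' *\<^sub>R iexp (t * Z n \<omega>') \<partial>M) /\<^sub>R prob (atom n ?w)"
          unfolding K_def using * by (intro char_atom_distr Z_meas atom_events) auto
        \<comment> \<open>On the atom the current estimate equals its value along the fixed path, so
          the centring becomes deterministic.\<close>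
        also have "(\<integral>\<omega>'. indicator (atom n ?w) \<omega>' *\<^sub>R iexp (t * Z n \<omega>') \<partial>M)
          = (\<integral>\<omega>'. indicator (atom n ?w) \<omega>' *\<^sub>R iexp (?s n * (bayes_est (Glim \<omega>') y - bayes_est (G ?w) y)) \<partial>M)"
          by (intro Bochner_Integration.integral_cong)
             (auto simp: Z_def tail mult.assoc split: split_indicator)
        finally have eq: "char (K n \<omega>) t = \<dots> /\<^sub>R prob (atom n ?w)" .
        have "(\<lambda>j. (\<alpha> (Suc (n + j)))\<^sup>2) sums T (Suc n)"
          using summable_sums[OF sq[of "Suc n"]] by (simp add: T_def)
        then show ?thesis
          unfolding eq using * by (intro expectation_atom_approx[OF Glim weak anti]) auto
      qed
      \<comment> \<open>Here \<open>T (Suc n) / T n = 1 - (\<alpha> n)^2 / T n\<close>, which is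
        where the vanishing ratio enters.\<close>
      have bS: "(\<lambda>n. (1 / T n) * T (Suc n)) \<longlonglongrightarrow> 1"
      proof -
        have "(\<lambda>n. 1 - (\<alpha> n)\<^sup>2 / T n) \<longlonglongrightarrow> 1 - 0" by (intro tendsto_intros ratio)
        moreover have "\<forall>\<^sub>F n in sequentially. 1 - (\<alpha> n)\<^sup>2 / T n = (1 / T n) * T (Suc n)"
          using eventually_ge_at_top[of 1]
        proof eventually_elim
          case (elim n)
          then show ?case using T_pos[of n] T_Suc[of n] by (simp add: field_simps)
        qed
        ultimately show ?thesis by (auto intro: Lim_transform_eventually)
      qed
      \<comment> \<open>The largest remaining rate is \<open>\<alpha> (Suc n)\<close>; monotonicity
        bounds it by \<open>\<alpha> n\<close> and leads back to \<open>ratio\<close>.\<close>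
      have cb: "(\<lambda>n. (\<alpha> (Suc n))\<^sup>2 * (1 / T n)) \<longlonglongrightarrow> 0"
      proof (rule tendsto_sandwich[OF _ _ tendsto_const ratio])
        show "\<forall>\<^sub>F n in sequentially. 0 \<le> (\<alpha> (Suc n))\<^sup>2 * (1 / T n)"
          using eventually_ge_at_top[of 1] by eventually_elim (simp add: T_pos less_imp_le)
        show "\<forall>\<^sub>F n in sequentially. (\<alpha> (Suc n))\<^sup>2 * (1 / T n) \<le> (\<alpha> n)\<^sup>2 / T n"
          using eventually_ge_at_top[of 1]
        proof eventually_elim
          case (elim n)
          then have "(\<alpha> (Suc n))\<^sup>2 \<le> (\<alpha> n)\<^sup>2"
            using anti[of n "Suc n"] rate[of "Suc n"] by (intro power_mono) auto
          then show ?case using T_pos[OF elim] by (simp add: divide_right_mono)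
        qed
      qed
      have "(\<lambda>n. clt_error y (\<alpha> (Suc n)) (T (Suc n)) (?s n)) \<longlonglongrightarrow> 0"
      proof (rule clt_error_tendsto_0[OF _ T_0 bS cb])
        show "\<forall>\<^sub>F n in sequentially. 0 \<le> \<alpha> (Suc n) \<and> 0 \<le> T (Suc n) \<and> 0 \<le> 1 / T n"
          using eventually_ge_at_top[of 1] by eventually_elim (simp add: T_pos rate less_imp_le)
      qed
      then have "(\<lambda>n. char (K n \<omega>) t - exp (- ((?s n)\<^sup>2 * T (Suc n) * ?V n / 2))) \<longlonglongrightarrow> 0"
        by (rule Lim_null_comparison[rotated])
           (rule eventually_sequentiallyI[OF bound])
      moreover have "(\<lambda>n. complex_of_real (exp (- ((?s n)\<^sup>2 * T (Suc n) * ?V n / 2)))) \<longlonglongrightarrow> exp (- (t\<^sup>2 * ?W / 2))"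
      proof -
        have "(\<lambda>n. - (t\<^sup>2 * ((1 / T n) * T (Suc n)) * ?V n / 2)) \<longlonglongrightarrow> - (t\<^sup>2 * 1 * ?W / 2)"
          by (intro tendsto_intros bS V) simp
        moreover have "\<forall>\<^sub>F n in sequentially. - (t\<^sup>2 * ((1 / T n) * T (Suc n)) * ?V n / 2)
            = - ((?s n)\<^sup>2 * T (Suc n) * ?V n / 2)"
          using eventually_ge_at_top[of 1]
        proof eventually_elim
          case (elim n)
          have "(?s n)\<^sup>2 = t\<^sup>2 * (1 / T n)"
            unfolding power_mult_distrib using T_pos[OF elim] by (subst real_sqrt_pow2) auto
          then show ?case by simp
        qed
        ultimately have "(\<lambda>n. - ((?s n)\<^sup>2 * T (Suc n) * ?V n / 2)) \<longlonglongrightarrow> - (t\<^sup>2 * ?W / 2)"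
          by (auto intro: Lim_transform_eventually)
        then show ?thesis by (intro tendsto_of_real tendsto_exp)
      qed
      ultimately have "(\<lambda>n. char (K n \<omega>) t) \<longlonglongrightarrow> exp (- (t\<^sup>2 * ?W / 2))"
        using tendsto_add by fastforce
      then show "(\<lambda>n. char (K n \<omega>) t) \<longlonglongrightarrow> char (centered_gaussian ?W) t"
        by (simp add: char_centered_gaussian[OF limit_variance_nonneg[OF Gl]])
    qed
  qed
  then show ?thesis
    unfolding cond_distr_conv_gaussian_def
    using measurable_limit_variance[OF Glim, of y] limit_variance_nonneg measurable_space[OF Glim] K
    by (auto simp: Z_def[abs_def] state_history intro!: exI[of _ K])
qed

end
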